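(* Let $\Bbbk$ be a field of characteristic zero, let $d\ge 3$, $m\ge 1$, let $n_1,\dots,n_d$ be positive integers, let $\mathbf r=(r_1,\dots,r_m)$ with all $r_k\ge 2$, and put $R=r_1\cdots r_m$. Let $\mathcal T\in\Bbbk^{n_1\times\cdots\times n_d}$ admit a generic $\mathbf r$-Hadamard--Hitchcock decomposition $$\mathcal T=\Big(\sum_{i_1=1}^{r_1}\mathcal A_{1i_1}\Big)\circledast\cdots\circledast\Big(\sum_{i_m=1}^{r_m}\mathcal A_{mi_m}\Big),\qquad \mathcal A_{ki_k}\text{ of rank }1 .$$ (1) If $\mathcal T$ is $R$-identifiable, then the rank-$1$ tensors $\mathcal A_{ki_k}$ are uniquely determined up to the following symmetries: (i) permuting Hadamard factors of equal length; (ii) permuting the summands in any Hadamard factor; (iii) Hadamard multiplication of the Hadamard factors by rank-$1$ tensors with nonzero entries. That is, for every other $\mathbf r$-Hadamard--Hitchcock decomposition of $\mathcal T$ with rank-$1$ tensors $\mathcal A'_{ki_k}$ ($k\in[m]$, $i_k\in[r_k]$) there exist a permutation $\psi$ of $[m]$ with $r_{\psi(k)}=r_k$ for all $k$, permutations $\pi_k$ of $[r_k]$, and rank-$1$ tensors $\mathcal D_1,\dots,\mathcal D_m\in\Bbbk^{n_1\times\cdots\times n_d}$ with all entries nonzero and $\mathcal D_1\circledast\cdots\circledast\mathcal D_m=\mathds 1$ such that $\mathcal A'_{k i}=\mathcal D_k\circledast\mathcal A_{\psi(k)\,\pi_k(i)}$ for all $k\in[m]$, $i\in[r_k]$. (2)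 If moreover $R$ lies in the range of the reshaped Kruskal criterion for $(n_1,\dots,n_d)$, then a generic $\mathcal T$ admitting an $\mathbf r$-Hadamard--Hitchcock decomposition is $R$-identifiable, and hence satisfies the conclusion of (1).
   Context: Notation: $[s]=\{1,\dots,s\}$; $\Bbbk^{n_1\times\cdots\times n_d}=\Bbbk^{n_1}\otimes\cdots\otimes\Bbbk^{n_d}$ is the space of order-$d$ arrays; $\circledast$ is the entrywise (Hadamard) product of arrays; $\mathds 1$ is the array with all entries equal to $1$. A rank-$1$ tensor is a tensor $\mathbf a_1\otimes\cdots\otimes\mathbf a_d$ with all $\mathbf a_i\in\Bbbk^{n_i}$ nonzero. The rank of a tensor is the minimal number of rank-$1$ tensors summing to it. $\mathbf r$-Hadamard--Hitchcock decomposition ($\mathbf r$-HHD) of $\mathcal T$: an expression of $\mathcal T$ as the Hadamard product over $k=1,\dots,m$ of sums $\sum_{i_k=1}^{r_k}\mathcal A_{ki_k}$ of $r_k$ rank-$1$ tensors; the $k$-th such sum is the $k$-th Hadamard factor and $r_k$ is its length. $R$-identifiable: $\mathcal T$ has rank $R$ and there is exactly one set $\{\mathcal B_1,\dots,\mathcal B_R\}$ of rank-$1$ tensors (up to reordering) with $\mathcal T=\mathcal B_1+\cdots+\mathcal B_R$. Generic: let $\mathcal S$ be the Segre variety (the set of rank-$1$ tensors in $\Bbbk^{n_1\times\cdots\times n_d}$ together with $0$). A statement holds for (a tensor $\mathcal T$ admitting) a generic $\mathbf r$-HHD if there is a proper Zariski-closed subset $\mathcal Z\subsetneq\mathcal S^{\times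 r_1}\times\cdots\times\mathcal S^{\times r_m}$ such that it holds whenever the tuple $(\mathcal A_{ki_k})$ of rank-$1$ tensors is not in $\mathcal Z$, with $\mathcal T$ the tensor defined by that tuple. Range of the reshaped Kruskal criterion: $R$ lies in it if there is a partition $I\sqcup J\sqcup K=[d]$ such that, with $\Pi_X=\prod_{x\in X}n_x$, one has $\Pi_I\ge\Pi_J\ge\Pi_K\ge2$ and $R\le\Pi_I+\min\{\tfrac12\delta,\delta\}$, where $\delta=\Pi_J+\Pi_K-\Pi_I-2$. *)

theory Defs
  imports Complex_Main "HOL-Library.FuncSet" "HOL-Combinatorics.Permutations"
begin

(* An array of format n 1 x ... x n d is a function on multi-indices x (with x j in {1..n j}
   for j in {1..d}) that is 0 off the finite set of multi-indices, so that equality of arrays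
   is equality of functions. *)

type_synonym 'k tensor = "(nat \<Rightarrow> nat) \<Rightarrow> 'k"

definition multi_indices :: "nat \<Rightarrow> (nat \<Rightarrow> nat) \<Rightarrow> (nat \<Rightarrow> nat) set" where
  "multi_indices d n = (\<Pi>\<^sub>E j\<in>{1..d}. {1..n j})"

definition hadamard :: "'k::comm_ring_1 tensor \<Rightarrow> 'k tensor \<Rightarrow> 'k tensor" where
  "hadamard S T = (\<lambda>x. S x * T x)"

(* Only used for nonempty K, where the product of arrays is again 0 off the multi-indices. *)
definition hadamard_prod :: "'i set \<Rightarrow> ('i \<Rightarrow> 'k::comm_ring_1 tensor) \<Rightarrow> 'k tensor" where
  "hadamard_prod K F = (\<lambda>x. \<Prod>k\<in>K. F k x)"

definition ones_tensor :: "nat \<Rightarrow> (nat \<Rightarrow> nat) \<Rightarrow> 'k::comm_ring_1 tensor" where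
  "ones_tensor d n = (\<lambda>x. if x \<in> multi_indices d n then 1 else 0)"

definition rank_one :: "nat \<Rightarrow> (nat \<Rightarrow> nat) \<Rightarrow> 'k::comm_ring_1 tensor \<Rightarrow> bool" where
  "rank_one d n T \<longleftrightarrow>
     (\<exists>a :: nat \<Rightarrow> nat \<Rightarrow> 'k.
        (\<forall>j\<in>{1..d}. \<exists>y\<in>{1..n j}. a j y \<noteq> 0) \<and>
        T = (\<lambda>x. if x \<in> multi_indices d n then \<Prod>j\<in>{1..d}. a j (x j) else 0))"

definition segre :: "nat \<Rightarrow> (nat \<Rightarrow> nat) \<Rightarrow> 'k::comm_ring_1 tensor set" where
  "segre d n = {T. rank_one d n T \<or> T = (\<lambda>x. 0)}"

definition tensor_rank :: "nat \<Rightarrow> (nat \<Rightarrow> nat) \<Rightarrow> 'k::comm_ring_1 tensor \<Rightarrow> nat" where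
  "tensor_rank d n T =
     (LEAST s. \<exists>B :: nat \<Rightarrow> 'k tensor.
        (\<forall>i\<in>{1..s}. rank_one d n (B i)) \<and> T = (\<lambda>x. \<Sum>i\<in>{1..s}. B i x))"

(* Unordered decompositions are sets of exactly R tensors: over a field of characteristic zero,
   a decomposition of a rank-R tensor into R rank-1 tensors has no repeated summand, since
   B + B = 2B has rank 1. *)
definition identifiable :: "nat \<Rightarrow> (nat \<Rightarrow> nat) \<Rightarrow> nat \<Rightarrow> 'k::field_char_0 tensor \<Rightarrow> bool" where
  "identifiable d n R T \<longleftrightarrow>
     tensor_rank d n T = R \<and>
     (\<exists>!\<B> :: 'k tensor set.
        finite \<B> \<and> card \<B> = R \<and> (\<forall>B\<in>\<B>. rank_one d n B) \<and> T = (\<lambda>x. \<Sum>B\<in>\<B>. B x))"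

definition rank_one_tuples ::
  "nat \<Rightarrow> (nat \<Rightarrow> nat) \<Rightarrow> nat \<Rightarrow> (nat \<Rightarrow> nat) \<Rightarrow> (nat \<Rightarrow> nat \<Rightarrow> 'k::comm_ring_1 tensor) set" where
  "rank_one_tuples d n m r = (\<Pi>\<^sub>E k\<in>{1..m}. \<Pi>\<^sub>E i\<in>{1..r k}. {T. rank_one d n T})"

definition segre_tuples ::
  "nat \<Rightarrow> (nat \<Rightarrow> nat) \<Rightarrow> nat \<Rightarrow> (nat \<Rightarrow> nat) \<Rightarrow> (nat \<Rightarrow> nat \<Rightarrow> 'k::comm_ring_1 tensor) set" where
  "segre_tuples d n m r = (\<Pi>\<^sub>E k\<in>{1..m}. \<Pi>\<^sub>E i\<in>{1..r k}. segre d n)"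

definition hadamard_of_sums ::
  "nat \<Rightarrow> (nat \<Rightarrow> nat) \<Rightarrow> (nat \<Rightarrow> nat \<Rightarrow> 'k::comm_ring_1 tensor) \<Rightarrow> 'k tensor" where
  "hadamard_of_sums m r A = hadamard_prod {1..m} (\<lambda>k x. \<Sum>i\<in>{1..r k}. A k i x)"

definition is_HHD ::
  "nat \<Rightarrow> (nat \<Rightarrow> nat) \<Rightarrow> nat \<Rightarrow> (nat \<Rightarrow> nat) \<Rightarrow>
     'k::comm_ring_1 tensor \<Rightarrow> (nat \<Rightarrow> nat \<Rightarrow> 'k tensor) \<Rightarrow> bool" where
  "is_HHD d n m r T A \<longleftrightarrow> A \<in> rank_one_tuples d n m r \<and> T = hadamard_of_sums m r A"

(* The algebra of polynomial functions in the coordinate functions X. *)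
inductive_set polynomial_functions :: "('p \<Rightarrow> 'k::comm_ring_1) set \<Rightarrow> ('p \<Rightarrow> 'k) set"
  for X :: "('p \<Rightarrow> 'k) set" where
  const: "(\<lambda>_. c) \<in> polynomial_functions X"
| coord: "f \<in> X \<Longrightarrow> f \<in> polynomial_functions X"
| add: "f \<in> polynomial_functions X \<Longrightarrow> g \<in> polynomial_functions X \<Longrightarrow>
          (\<lambda>p. f p + g p) \<in> polynomial_functions X"
| mult: "f \<in> polynomial_functions X \<Longrightarrow> g \<in> polynomial_functions X \<Longrightarrow>
          (\<lambda>p. f p * g p) \<in> polynomial_functions X"

definition tuple_coordinates ::
  "nat \<Rightarrow> (nat \<Rightarrow> nat) \<Rightarrow> nat \<Rightarrow> (nat \<Rightarrow> nat) \<Rightarrow>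
     ((nat \<Rightarrow> nat \<Rightarrow> 'k::comm_ring_1 tensor) \<Rightarrow> 'k) set" where
  "tuple_coordinates d n m r =
     {(\<lambda>A. A k i x) | k i x. k \<in> {1..m} \<and> i \<in> {1..r k} \<and> x \<in> multi_indices d n}"

definition zariski_closed_in_segre_tuples ::
  "nat \<Rightarrow> (nat \<Rightarrow> nat) \<Rightarrow> nat \<Rightarrow> (nat \<Rightarrow> nat) \<Rightarrow>
     (nat \<Rightarrow> nat \<Rightarrow> 'k::comm_ring_1 tensor) set \<Rightarrow> bool" where
  "zariski_closed_in_segre_tuples d n m r Z \<longleftrightarrow>
     (\<exists>P \<subseteq> polynomial_functions (tuple_coordinates d n m r).
        Z = {A \<in> segre_tuples d n m r. \<forall>p\<in>P. p A = 0})"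

definition for_generic_HHD ::
  "nat \<Rightarrow> (nat \<Rightarrow> nat) \<Rightarrow> nat \<Rightarrow> (nat \<Rightarrow> nat) \<Rightarrow>
     ('k::comm_ring_1 tensor \<Rightarrow> (nat \<Rightarrow> nat \<Rightarrow> 'k tensor) \<Rightarrow> bool) \<Rightarrow> bool" where
  "for_generic_HHD d n m r Q \<longleftrightarrow>
     (\<exists>Z. zariski_closed_in_segre_tuples d n m r Z \<and> Z \<subset> segre_tuples d n m r \<and>
        (\<forall>T A. is_HHD d n m r T A \<and> A \<notin> Z \<longrightarrow> Q T A))"

definition HHD_unique_up_to_symmetries ::
  "nat \<Rightarrow> (nat \<Rightarrow> nat) \<Rightarrow> nat \<Rightarrow> (nat \<Rightarrow> nat) \<Rightarrow>
     'k::comm_ring_1 tensor \<Rightarrow> (nat \<Rightarrow> nat \<Rightarrow> 'k tensor) \<Rightarrow> bool" where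
  "HHD_unique_up_to_symmetries d n m r T A \<longleftrightarrow>
     (\<forall>A'. is_HHD d n m r T A' \<longrightarrow>
        (\<exists>(\<psi> :: nat \<Rightarrow> nat) (\<pi> :: nat \<Rightarrow> nat \<Rightarrow> nat) (D :: nat \<Rightarrow> 'k tensor).
           \<psi> permutes {1..m} \<and>
           (\<forall>k\<in>{1..m}. r (\<psi> k) = r k) \<and>
           (\<forall>k\<in>{1..m}. \<pi> k permutes {1..r k}) \<and>
           (\<forall>k\<in>{1..m}. rank_one d n (D k) \<and> (\<forall>x\<in>multi_indices d n. D k x \<noteq> 0)) \<and>
           hadamard_prod {1..m} D = ones_tensor d n \<and>
           (\<forall>k\<in>{1..m}. \<forall>i\<in>{1..r k}. A' k i = hadamard (D k) (A (\<psi> k) (\<pi> k i)))))"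

definition in_reshaped_kruskal_range :: "nat \<Rightarrow> (nat \<Rightarrow> nat) \<Rightarrow> nat \<Rightarrow> bool" where
  "in_reshaped_kruskal_range d n R \<longleftrightarrow>
     (\<exists>I J K. I \<union> J \<union> K = {1..d} \<and> I \<inter> J = {} \<and> I \<inter> K = {} \<and> J \<inter> K = {} \<and>
        (let PI = \<Prod>j\<in>I. n j; PJ = \<Prod>j\<in>J. n j; PK = \<Prod>j\<in>K. n j;
             \<delta> = real PJ + real PK - real PI - 2
         in PI \<ge> PJ \<and> PJ \<ge> PK \<and> PK \<ge> 2 \<and> real R \<le> real PI + min (\<delta> / 2) \<delta>))"

end

theory Submission
  imports Defs "HOL-Library.Function_Algebras" "HOL-Library.Nat_Bijection"
    "HOL-Computational_Algebra.Primes"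
begin

text \<open>Expanding the Hadamard product writes \<open>T\<close> as a sum of \<open>R\<close> rank-one tensors indexed by the grid
  \<open>[r\<^sub>1] \<times> \<dots> \<times> [r\<^sub>m]\<close>. If \<open>T\<close> is \<open>R\<close>-identifiable, two decompositions of \<open>T\<close> differ by a bijection
  of the grid. Summands at opposite corners of an axis-parallel rectangle have the same Hadamard
  product as those at the other two corners, and for generic \<open>A\<close> the values of the summands at a
  single entry satisfy no other multiplicative relation of this kind. Hence the bijection permutes
  coordinates and acts separately in each of them; the remaining freedom is division of the factors.

  For the second part, Kruskal's theorem is applied after reshaping. It follows from the bound
  \<open>d\<^sub>1 + d\<^sub>2 + d\<^sub>3 \<le> N + 1\<close> for the dimensions spanned by the factors of \<open>N\<close> product tensors with
  vanishing sum and no vanishing proper partial sum. All genericity conditions are Zariski open, and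
  they hold simultaneously at one explicit tuple.\<close>

section \<open>Dimensions of families of vectors\<close>

text \<open>How the dimension bound yields uniqueness is a matter of counting. The difference of two
  decompositions is a vanishing signed sum, which breaks up into minimal vanishing ones. One of
  these has at least as many given terms, say p, as competing terms, so N \<le> 2p and its
  dimensions add up to at most 2p + 1. Families spanning 2p + 2 dimensions whenever p \<ge> 2 thus
  force p = 1: one given term equals one competitor. Competitors enter only through their number, so
  only the given decomposition has to be generic.

  Genericity must be polynomial in the entries of the tensors, while the vectors in a rank-one
  tensor are determined only up to scalars; all conditions are therefore read off from entries. The
  witness has to serve two purposes: unique factorization excludes multiplicative relations at one
  entry, and powers of distinct numbers give linear independence in each reshaped factor.\<close>

context vector_space
begin

lemma dim_le_finite: "V \<subseteq> span W \<Longrightarrow> finite W \<Longrightarrow> dim V \<le> dim W"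
  using basis_exists[of W]
  by (metis dim_le_card finite_subset span_span subset_trans span_mono span_superset)

lemma dim_insert_notin_span:
  assumes "finite G" "v \<notin> span G"
  shows "dim (insert v G) = Suc (dim G)"
proof -
  obtain B where B: "B \<subseteq> G" "independent B" "G \<subseteq> span B" "card B = dim G"
    using basis_exists by metis
  have sp: "span B = span G"
    using B by (metis span_eq span_superset subset_trans)
  have "insert v B \<subseteq> insert v G" "independent (insert v B)"
    using B assms sp independent_insertI[of v B] by auto
  moreover have "insert v G \<subseteq> span (insert v B)"
    using B(3) span_mono[of B "insert v B"] by (auto intro: span_base)
  ultimately have "dim (insert v G) = card (insert v B)"
    by (metis basis_card_eq_dim)
  moreover have "v \<notin> B" "finite B"
    using assms B sp by (auto intro: span_base finite_subset)
  ultimately show ?thesis using B by simp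
qed

text \<open>Coefficients are indexed by \<open>S\<close> itself and not by its image, so that
  families with repeated members need no passage to sets of vectors.\<close>

lemma span_Un_image_coeffs:
  assumes "finite S" "v \<in> span (G \<union> f ` S)"
  shows "\<exists>c. v - (\<Sum>a\<in>S. c a *s f a) \<in> span G"
  using assms
proof (induction S arbitrary: v rule: finite_induct)
  case empty
  then show ?case by simp
next
  case (insert s S)
  then obtain k where "v - k *s f s \<in> span (G \<union> f ` S)"
    by (auto simp: span_breakdown_eq)
  from insert.IH[OF this] obtain c where c: "v - k *s f s - (\<Sum>a\<in>S. c a *s f a) \<in> span G"
    by blast
  have "(\<Sum>a\<in>S. (c(s := k)) a *s f a) = (\<Sum>a\<in>S. c a *s f a)"
    using insert.hyps by (intro sum.cong) auto
  then have "v - (\<Sum>a\<in>insert s S. (c(s := k)) a *s f a) \<in> span G"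
    using c insert.hyps by (simp add: algebra_simps)
  then show ?case by blast
qed

text \<open>The hypothesis is independence of the family in the quotient by \<open>span G\<close>,
  phrased without forming the quotient; it also excludes repetitions. Each member therefore raises
  the dimension by one.\<close>

lemma card_le_dim_of_independent_mod:
  assumes "finite S" "finite G"
    and "\<And>c. (\<Sum>a\<in>S. c a *s f a) \<in> span G \<Longrightarrow> \<forall>a\<in>S. c a = 0"
  shows "dim G + card S \<le> dim (G \<union> f ` S)"
  using assms(1,3)
proof (induction S rule: finite_induct)
  case empty
  then show ?case by simp
next
  case (insert s S)
  have sub: "\<forall>a\<in>S. c a = 0" if "(\<Sum>a\<in>S. c a *s f a) \<in> span G" for c
  proof -
    have "(\<Sum>a\<in>S. (c(s := 0)) a *s f a) = (\<Sum>a\<in>S. c a *s f a)"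
      using insert.hyps by (intro sum.cong) auto
    then have "(\<Sum>a\<in>insert s S. (c(s := 0)) a *s f a) \<in> span G"
      using that insert.hyps by simp
    from insert.prems[OF this] show ?thesis
      using insert.hyps by (auto split: if_splits)
  qed
  have "f s \<notin> span (G \<union> f ` S)"
  proof
    assume "f s \<in> span (G \<union> f ` S)"
    then obtain c where c: "f s - (\<Sum>a\<in>S. c a *s f a) \<in> span G"
      using span_Un_image_coeffs[OF insert.hyps(1)] by blast
    have "(\<Sum>a\<in>S. ((\<lambda>a. - c a)(s := 1)) a *s f a) = - (\<Sum>a\<in>S. c a *s f a)"
      unfolding sum_negf[symmetric] using insert.hyps by (intro sum.cong) auto
    then have "(\<Sum>a\<in>insert s S. ((\<lambda>a. - c a)(s := 1)) a *s f a) \<in> span G"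
      using c insert.hyps by simp
    from insert.prems[OF this] show False by auto
  qed
  then have "dim (insert (f s) (G \<union> f ` S)) = Suc (dim (G \<union> f ` S))"
    using insert.hyps assms(2) by (intro dim_insert_notin_span) auto
  then show ?case
    using insert.IH[OF sub] insert.hyps by simp
qed

text \<open>Greedy choice of a basis modulo \<open>span G\<close>. Selecting indices rather than
  vectors makes it possible to compare with a second family on the same indices in Sylvester's
  inequality.\<close>

lemma basis_mod:
  assumes "finite C"
  shows "\<exists>S\<subseteq>C. f ` C \<subseteq> span (G \<union> f ` S) \<and>
           (\<forall>c. (\<Sum>a\<in>S. c a *s f a) \<in> span G \<longrightarrow> (\<forall>a\<in>S. c a = 0))"
  using assms
proof (induction C rule: finite_induct)
  case empty
  then show ?case by simp
next
  case (insert b C)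
  then obtain S where S: "S \<subseteq> C" "f ` C \<subseteq> span (G \<union> f ` S)"
    "\<And>c. (\<Sum>a\<in>S. c a *s f a) \<in> span G \<Longrightarrow> \<forall>a\<in>S. c a = 0" by blast
  show ?case
  proof (cases "f b \<in> span (G \<union> f ` S)")
    case True
    then show ?thesis using S by (intro exI[of _ S]) auto
  next
    case False
    have fin: "finite S" "b \<notin> S" using S(1) insert.hyps finite_subset by auto
    have "\<forall>a\<in>insert b S. c a = 0" if c: "(\<Sum>a\<in>insert b S. c a *s f a) \<in> span G" for c
    proof -
      have "c b = 0"
      proof (rule ccontr)
        assume nz: "c b \<noteq> 0"
        have "c b *s f b + (\<Sum>a\<in>S. c a *s f a) \<in> span (G \<union> f ` S)"
          using c fin span_mono[of G "G \<union> f ` S"] by auto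
        moreover have "(\<Sum>a\<in>S. c a *s f a) \<in> span (G \<union> f ` S)"
          by (intro span_sum span_scale span_base) auto
        ultimately have "c b *s f b \<in> span (G \<union> f ` S)"
          by (metis add_diff_cancel_right' span_diff)
        then have "inverse (c b) *s (c b *s f b) \<in> span (G \<union> f ` S)"
          by (rule span_scale)
        then show False using nz False by simp
      qed
      then show ?thesis using c fin S(3) by auto
    qed
    moreover have "f ` insert b C \<subseteq> span (G \<union> f ` insert b S)"
      using S(2) span_mono[of "G \<union> f ` S" "G \<union> f ` insert b S"] by (auto intro: span_base)
    ultimately show ?thesis using S(1) by (intro exI[of _ "insert b S"]) auto
  qed
qed

text \<open>Both spans have bases through \<open>v\<close>, so the union of these bases has at least
  one element fewer than the two together.\<close>

lemma dim_Un_le_of_common_vector: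
  assumes "finite G" "finite H" "v \<in> span G" "v \<in> span H" "v \<noteq> 0"
  shows "dim (G \<union> H) + 1 \<le> dim G + dim H"
proof -
  have basis: "\<exists>B. v \<in> B \<and> finite B \<and> card B = dim U \<and> U \<subseteq> span B"
    if U: "finite U" "v \<in> span U" for U
  proof -
    have v: "{v} \<subseteq> span U" "independent {v}" using U(2) assms(5) by simp_all
    obtain B where B: "{v} \<subseteq> B" "B \<subseteq> span U" "independent B" "span U \<subseteq> span B"
      using maximal_independent_subset_extend[OF v] .
    have "finite B" using independent_span_bound[OF U(1) B(3,2)] by simp
    moreover have "card B = dim U"
      using basis_card_eq_dim[OF B(2,4,3)] by simp
    moreover have "U \<subseteq> span B" using B(4) span_superset[of U] by (rule_tac subset_trans)
    ultimately show ?thesis using B(1) by (intro exI[of _ B]) simp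
  qed
  obtain B where B: "v \<in> B" "finite B" "card B = dim G" "G \<subseteq> span B"
    using basis assms by blast
  obtain D where D: "v \<in> D" "finite D" "card D = dim H" "H \<subseteq> span D"
    using basis assms by blast
  have "G \<union> H \<subseteq> span (B \<union> D)"
    using B(4) D(4) span_mono[of B "B \<union> D"] span_mono[of D "B \<union> D"] by auto
  then have "dim (G \<union> H) \<le> card (B \<union> D)" using B D by (intro dim_le_card) auto
  moreover have "card (B \<inter> D) \<ge> 1"
    using B D by (metis IntI card_0_eq finite_Int empty_iff less_one not_le)
  ultimately show ?thesis
    using card_Un_Int[OF B(2) D(2)] B D by linarith
qed

end

section \<open>Function spaces and products of two families\<close>

definition fscale :: "'k::field \<Rightarrow> ('p \<Rightarrow> 'k) \<Rightarrow> 'p \<Rightarrow> 'k" where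
  "fscale c f = (\<lambda>p. c * f p)"

text \<open>Vectors are functions on an arbitrary type, so the ambient space may be
  infinite-dimensional; \<open>fun_vs.dim\<close> is applied to finite families and measures their
  span.\<close>

interpretation fun_vs: vector_space fscale
  by unfold_locales (auto simp: fscale_def fun_eq_iff algebra_simps)

lemma sum_fun_apply: "(\<Sum>a\<in>A. f a) p = (\<Sum>a\<in>A. f a p)"
  for f :: "'a \<Rightarrow> 'p \<Rightarrow> 'k::comm_monoid_add"
  by (induction A rule: infinite_finite_induct) auto

lemma fscale_apply [simp]: "fscale c f p = c * f p"
  by (simp add: fscale_def)

text \<open>Taking \<open>G\<close> empty, this is Sylvester's rank inequality for a vanishing product of two matrices.\<close>
lemma sylvester_mod:
  fixes x :: "'e \<Rightarrow> 'p \<Rightarrow> 'k::field" and y :: "'e \<Rightarrow> 'q \<Rightarrow> 'k"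
  assumes "finite C" "finite G"
    and rel: "\<And>q. (\<Sum>c\<in>C. fscale (y c q) (x c)) \<in> fun_vs.span G"
  shows "fun_vs.dim (G \<union> x ` C) + fun_vs.dim (y ` C) \<le> fun_vs.dim G + card C"
proof -
  obtain S where S: "S \<subseteq> C" "x ` C \<subseteq> fun_vs.span (G \<union> x ` S)"
    "\<And>c. (\<Sum>a\<in>S. fscale (c a) (x a)) \<in> fun_vs.span G \<Longrightarrow> \<forall>a\<in>S. c a = 0"
    using fun_vs.basis_mod[OF assms(1), of x G] by blast
  have fin: "finite S" "finite (C - S)" using S(1) assms(1) finite_subset by auto
  have "\<exists>k. x b - (\<Sum>a\<in>S. fscale (k a) (x a)) \<in> fun_vs.span G" if "b \<in> C" for b
    using fun_vs.span_Un_image_coeffs[OF fin(1), of "x b" G x] S(2) that by blast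
  then obtain k where k: "\<And>b. b \<in> C \<Longrightarrow> x b - (\<Sum>a\<in>S. fscale (k b a) (x a)) \<in> fun_vs.span G"
    by metis
  \<comment> \<open>Expanding each \<open>x b\<close> with \<open>b\<close> outside \<open>S\<close>
    through \<open>S\<close> modulo \<open>span G\<close> turns \<open>rel\<close> into a relation
    supported on \<open>S\<close>, whose coefficients vanish by the choice of \<open>S\<close>. So
    the family \<open>y\<close> is spanned by its members off \<open>S\<close>.\<close>
  have "y a q + (\<Sum>b\<in>C - S. k b a * y b q) = 0" if "a \<in> S" for a q
  proof -
    have "(\<Sum>b\<in>C - S. fscale (y b q) (x b - (\<Sum>a\<in>S. fscale (k b a) (x a)))) \<in> fun_vs.span G"
      using k by (intro fun_vs.span_sum fun_vs.span_scale) auto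
    with rel[of q] have "(\<Sum>c\<in>C. fscale (y c q) (x c)) -
        (\<Sum>b\<in>C - S. fscale (y b q) (x b - (\<Sum>a\<in>S. fscale (k b a) (x a)))) \<in> fun_vs.span G"
      by (rule fun_vs.span_diff)
    also have "(\<Sum>c\<in>C. fscale (y c q) (x c)) -
        (\<Sum>b\<in>C - S. fscale (y b q) (x b - (\<Sum>a\<in>S. fscale (k b a) (x a)))) =
        (\<Sum>a\<in>S. fscale (y a q + (\<Sum>b\<in>C - S. k b a * y b q)) (x a))"
    proof
      fix p
      have "(\<Sum>c\<in>C. y c q * x c p) = (\<Sum>c\<in>C - S. y c q * x c p) + (\<Sum>a\<in>S. y a q * x a p)"
        using S(1) assms(1) by (rule sum.subset_diff)
      moreover have "(\<Sum>b\<in>C - S. y b q * (\<Sum>a\<in>S. k b a * x a p)) =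
          (\<Sum>a\<in>S. (\<Sum>b\<in>C - S. k b a * y b q) * x a p)"
        by (simp add: sum_distrib_left sum_distrib_right sum.swap[of _ S] algebra_simps)
      ultimately show "((\<Sum>c\<in>C. fscale (y c q) (x c)) -
          (\<Sum>b\<in>C - S. fscale (y b q) (x b - (\<Sum>a\<in>S. fscale (k b a) (x a))))) p =
          (\<Sum>a\<in>S. fscale (y a q + (\<Sum>b\<in>C - S. k b a * y b q)) (x a)) p"
        by (simp add: sum_fun_apply right_diff_distrib sum_subtractf distrib_right sum.distrib)
    qed
    finally have "(\<Sum>a\<in>S. fscale (y a q + (\<Sum>b\<in>C - S. k b a * y b q)) (x a)) \<in> fun_vs.span G" .
    from S(3)[OF this] show ?thesis using that by blast
  qed
  then have ya: "y a = (\<Sum>b\<in>C - S. fscale (- k b a) (y b))" if "a \<in> S" for a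
    using that by (auto simp: fun_eq_iff sum_fun_apply sum_negf eq_neg_iff_add_eq_0)
  have "y c \<in> fun_vs.span (y ` (C - S))" if "c \<in> C" for c
  proof (cases "c \<in> S")
    case True
    have "(\<Sum>b\<in>C - S. fscale (- k b c) (y b)) \<in> fun_vs.span (y ` (C - S))"
      by (intro fun_vs.span_sum fun_vs.span_scale fun_vs.span_base) auto
    then show ?thesis using ya[OF True] by simp
  qed (use that in \<open>auto intro: fun_vs.span_base\<close>)
  then have "fun_vs.dim (y ` C) \<le> card (y ` (C - S))"
    using fin by (intro fun_vs.dim_le_card) auto
  also have "\<dots> \<le> card (C - S)" using fin by (rule_tac card_image_le)
  finally have 1: "fun_vs.dim (y ` C) \<le> card C - card S"
    using S(1) assms(1) by (simp add: card_Diff_subset finite_subset)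
  obtain B where B: "B \<subseteq> G" "fun_vs.independent B" "G \<subseteq> fun_vs.span B" "card B = fun_vs.dim G"
    using fun_vs.basis_exists by metis
  have "G \<union> x ` S \<subseteq> fun_vs.span (B \<union> x ` S)"
    using B(3) fun_vs.span_mono[of B "B \<union> x ` S"] by (auto intro: fun_vs.span_base)
  then have "G \<union> x ` C \<subseteq> fun_vs.span (B \<union> x ` S)"
    using S(2) fun_vs.span_minimal[OF _ fun_vs.subspace_span] by blast
  then have "fun_vs.dim (G \<union> x ` C) \<le> card (B \<union> x ` S)"
    using fin B assms(2) by (intro fun_vs.dim_le_card) (auto intro: finite_subset)
  also have "\<dots> \<le> card B + card S"
    using card_Un_le[of B "x ` S"] card_image_le[OF fin(1), of x] by linarith
  finally show ?thesis using 1 B(4) card_mono[OF assms(1) S(1)] by linarith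
qed

definition outer :: "('p \<Rightarrow> 'k::field) \<Rightarrow> ('q \<Rightarrow> 'k) \<Rightarrow> 'p \<times> 'q \<Rightarrow> 'k" where
  "outer f g = (\<lambda>(p, q). f p * g q)"

lemma outer_apply [simp]: "outer f g (p, q) = f p * g q"
  by (simp add: outer_def)

section \<open>Kruskal's theorem\<close>

text \<open>The one-element case from which the enlargement starts. Over a field nonzero vectors
  have a nonzero product, and if exactly one vector vanishes the 1 on the right still
  suffices.\<close>

lemma dim_outer_singleton:
  fixes u :: "'p \<Rightarrow> 'k::field" and v :: "'q \<Rightarrow> 'k"
  shows "fun_vs.dim {u} + fun_vs.dim {v} \<le> fun_vs.dim {outer u v} + 1"
proof -
  have dim1: "fun_vs.dim {w} = (if w = 0 then 0 else 1)" for w :: "'r \<Rightarrow> 'k"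
  proof (cases "w = 0")
    case True
    then show ?thesis using fun_vs.dim_le_card[of "{w}" "{}"] by simp
  next
    case False
    then show ?thesis using fun_vs.dim_eq_card_independent[of "{w}"] by simp
  qed
  have "outer u v \<noteq> 0" if uv: "u \<noteq> 0" "v \<noteq> 0"
  proof -
    obtain p q where "u p \<noteq> 0" "v q \<noteq> 0" using uv by (auto simp: fun_eq_iff)
    then have "outer u v (p, q) \<noteq> 0" by simp
    then show ?thesis by (metis zero_fun_apply)
  qed
  then show ?thesis by (auto simp: dim1)
qed

text \<open>The two-factor case of the splitting theorem of Lovitz and Petrov: a family of product vectors
  that is connected as a matroid spans at least \<open>d\<^sub>1 + d\<^sub>2 - 1\<close> dimensions. A subfamily \<open>F\<close> with this
  property is enlarged by a smallest \<open>C\<close> whose span meets that of \<open>F\<close>.\<close>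
lemma dim_outer_ge_of_connected:
  fixes x :: "'e \<Rightarrow> 'p \<Rightarrow> 'k::field" and y :: "'e \<Rightarrow> 'q \<Rightarrow> 'k"
  defines "M \<equiv> \<lambda>a. outer (x a) (y a)"
  assumes "finite E" "E \<noteq> {}"
    and conn: "\<And>F. F \<noteq> {} \<Longrightarrow> F \<subset> E \<Longrightarrow>
                 \<exists>w. w \<noteq> 0 \<and> w \<in> fun_vs.span (M ` F) \<and> w \<in> fun_vs.span (M ` (E - F))"
  shows "fun_vs.dim (x ` E) + fun_vs.dim (y ` E) \<le> fun_vs.dim (M ` E) + 1"
proof -
  define good where "good F \<longleftrightarrow> F \<noteq> {} \<and> F \<subseteq> E \<and>
    fun_vs.dim (x ` F) + fun_vs.dim (y ` F) \<le> fun_vs.dim (M ` F) + 1" for F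
  obtain e where "e \<in> E" using assms(3) by blast
  then have "good {e}" using dim_outer_singleton by (simp add: good_def M_def)
  moreover have "\<forall>F. good F \<longrightarrow> card F \<le> card E"
    using assms(2) by (auto simp: good_def intro: card_mono)
  then have "\<forall>F. good F \<longrightarrow> card F < Suc (card E)" by (simp add: less_Suc_eq_le)
  ultimately have "\<exists>F. good F \<and> (\<forall>F'. good F' \<longrightarrow> card F' \<le> card F)"
    using ex_has_greatest_nat[of good "{e}" card "Suc (card E)"] by auto
  then obtain F where F: "good F" and max: "\<And>F'. good F' \<Longrightarrow> card F' \<le> card F"
    by blast
  have FE: "F \<subseteq> E" "F \<noteq> {}" "finite F"
    using F assms(2) finite_subset by (auto simp: good_def)
  have "F = E"
  proof (rule ccontr)
    assume "F \<noteq> E"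
    define rel where "rel C \<longleftrightarrow> C \<subseteq> E - F \<and>
      (\<exists>l. (\<Sum>c\<in>C. fscale (l c) (M c)) \<noteq> 0 \<and> (\<Sum>c\<in>C. fscale (l c) (M c)) \<in> fun_vs.span (M ` F))" for C
    have "rel (E - F)"
    proof -
      obtain w where w: "w \<noteq> 0" "w \<in> fun_vs.span (M ` F)" "w \<in> fun_vs.span ({} \<union> M ` (E - F))"
        using conn[of F] FE \<open>F \<noteq> E\<close> by auto
      obtain l where "w - (\<Sum>c\<in>E - F. fscale (l c) (M c)) \<in> fun_vs.span {}"
        using fun_vs.span_Un_image_coeffs[OF _ w(3)] assms(2) by auto
      then have "w = (\<Sum>c\<in>E - F. fscale (l c) (M c))" by simp
      then show ?thesis using w unfolding rel_def by blast
    qed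
    then obtain C where C: "rel C" and min: "\<And>C'. rel C' \<Longrightarrow> card C \<le> card C'"
      using ex_has_least_nat[of rel "E - F" card] by blast
    then have CE: "C \<subseteq> E - F" "finite C" using assms(2) finite_subset
      by (auto simp: rel_def)
    obtain l where l: "(\<Sum>c\<in>C. fscale (l c) (M c)) \<noteq> 0"
      "(\<Sum>c\<in>C. fscale (l c) (M c)) \<in> fun_vs.span (M ` F)"
      using C unfolding rel_def by blast
    define w where "w = (\<Sum>c\<in>C. fscale (l c) (M c))"
    have smaller: False if "c \<in> C" "w = (\<Sum>a\<in>C - {c}. fscale (\<mu> a) (M a))" for c \<mu>
    proof -
      have "rel (C - {c})" using that l CE unfolding rel_def w_def by auto
      from min[OF this] that CE show False
        by (metis card_Diff1_less not_le)
    qed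
    have "C \<noteq> {}" using l by auto
    then obtain c0 where c0: "c0 \<in> C" by blast
    have lnz: "l c \<noteq> 0" if "c \<in> C" for c
    proof
      assume "l c = 0"
      then have "w = (\<Sum>a\<in>C - {c}. fscale (l a) (M a))"
        using that CE unfolding w_def by (subst sum.remove[of _ c]) auto
      then show False using smaller that by blast
    qed
    \<comment> \<open>Without one member, \<open>C\<close> is independent modulo the span of
      \<open>F\<close>. A dependency with nonzero value would give a smaller set satisfying
      \<open>rel\<close>; one with value zero can be subtracted from \<open>w\<close>, scaled by
      \<open>l c1 / \<mu> c1\<close>, to eliminate \<open>c1\<close>. Hence \<open>C\<close> adds at
      least \<open>card C - 1\<close> dimensions to the products.\<close>
    have "\<forall>a\<in>C - {c0}. \<mu> a = 0"
      if \<mu>: "(\<Sum>a\<in>C - {c0}. fscale (\<mu> a) (M a)) \<in> fun_vs.span (M ` F)" for \<mu>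
    proof (rule ccontr)
      assume "\<not> (\<forall>a\<in>C - {c0}. \<mu> a = 0)"
      then obtain c1 where c1: "c1 \<in> C - {c0}" "\<mu> c1 \<noteq> 0" by blast
      have sum0: "(\<Sum>a\<in>C - {c0}. fscale (\<mu> a) (M a)) = 0"
      proof (rule ccontr)
        assume "(\<Sum>a\<in>C - {c0}. fscale (\<mu> a) (M a)) \<noteq> 0"
        then have "rel (C - {c0})" using \<mu> CE unfolding rel_def by auto
        from min[OF this] c0 CE show False by (metis card_Diff1_less not_le)
      qed
      define \<nu> where "\<nu> a = l a - (if a = c0 then 0 else l c1 / \<mu> c1 * \<mu> a)" for a
      have "w p = (\<Sum>a\<in>C. fscale (\<nu> a) (M a)) p" for p
      proof -
        have "(\<Sum>a\<in>C. (if a = c0 then 0 else l c1 / \<mu> c1 * \<mu> a) * M a p) =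
            (\<Sum>a\<in>C - {c0}. l c1 / \<mu> c1 * (\<mu> a * M a p))"
          using c0 CE by (subst sum.remove[of _ c0]) (auto intro!: sum.cong simp: mult.assoc)
        also have "\<dots> = l c1 / \<mu> c1 * (\<Sum>a\<in>C - {c0}. fscale (\<mu> a) (M a)) p"
          by (simp add: sum_fun_apply sum_distrib_left)
        finally have "(\<Sum>a\<in>C. (if a = c0 then 0 else l c1 / \<mu> c1 * \<mu> a) * M a p) = 0"
          using sum0 by simp
        then show ?thesis
          by (simp only: w_def \<nu>_def sum_fun_apply fscale_apply left_diff_distrib sum_subtractf diff_zero)
      qed
      then have "w = (\<Sum>a\<in>C. fscale (\<nu> a) (M a))" by (rule ext)
      also have "\<dots> = (\<Sum>a\<in>C - {c1}. fscale (\<nu> a) (M a))"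
      proof -
        have "fscale (\<nu> c1) (M c1) = 0"
          using c1 by (auto simp: \<nu>_def fun_eq_iff)
        then show ?thesis using c1 CE by (subst sum.remove[of _ c1]) auto
      qed
      finally show False using smaller c1 by blast
    qed
    then have "fun_vs.dim (M ` F) + card (C - {c0}) \<le> fun_vs.dim (M ` F \<union> M ` (C - {c0}))"
      using CE FE by (intro fun_vs.card_le_dim_of_independent_mod) auto
    also have "\<dots> \<le> fun_vs.dim (M ` (F \<union> C))"
      using CE FE by (intro fun_vs.dim_le_finite) (auto intro: fun_vs.span_base)
    finally have dimM: "fun_vs.dim (M ` F) + card C \<le> fun_vs.dim (M ` (F \<union> C)) + 1"
      using c0 CE by (simp add: card_Diff_singleton_if)
    obtain k where k: "w - (\<Sum>a\<in>F. fscale (k a) (M a)) \<in> fun_vs.span {}"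
      using fun_vs.span_Un_image_coeffs[of F w "{}" M] l FE by (auto simp: w_def)
    then have wF: "w = (\<Sum>a\<in>F. fscale (k a) (M a))" by simp
    have wFpq: "w (p, q) = (\<Sum>a\<in>F. k a * (x a p * y a q))" for p q
      by (simp add: wF sum_fun_apply M_def)
    have wCpq: "w (p, q) = (\<Sum>a\<in>C. l a * (x a p * y a q))" for p q
      by (simp add: w_def sum_fun_apply M_def)
    \<comment> \<open>Fixing the second index of \<open>w\<close> gives the hypothesis of
      Sylvester's inequality modulo the \<open>x\<close>-span of \<open>F\<close>: the new
      \<open>x\<close>-dimensions number at most \<open>card C\<close> minus the
      \<open>y\<close>-dimension of \<open>C\<close>.\<close>
    have "(\<Sum>c\<in>C. fscale (l c * y c q) (x c)) \<in> fun_vs.span (x ` F)" for q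
    proof -
      have "(\<Sum>c\<in>C. fscale (l c * y c q) (x c)) = (\<Sum>a\<in>F. fscale (k a * y a q) (x a))"
        using wFpq[of _ q] wCpq[of _ q] by (auto simp: fun_eq_iff sum_fun_apply algebra_simps)
      also have "\<dots> \<in> fun_vs.span (x ` F)"
        by (intro fun_vs.span_sum fun_vs.span_scale fun_vs.span_base) auto
      finally show ?thesis .
    qed
    then have sx: "fun_vs.dim (x ` F \<union> x ` C) + fun_vs.dim ((\<lambda>c q. l c * y c q) ` C) \<le>
        fun_vs.dim (x ` F) + card C"
      using CE FE by (intro sylvester_mod) auto
    have "y c \<in> fun_vs.span ((\<lambda>c q. l c * y c q) ` C)" if "c \<in> C" for c
    proof -
      have "fscale (inverse (l c)) (\<lambda>q. l c * y c q) \<in> fun_vs.span ((\<lambda>c q. l c * y c q) ` C)"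
        using that by (intro fun_vs.span_scale fun_vs.span_base) auto
      moreover have "fscale (inverse (l c)) (\<lambda>q. l c * y c q) = y c"
        using lnz[OF that] by (auto simp: fun_eq_iff field_simps)
      ultimately show ?thesis by simp
    qed
    then have sy: "fun_vs.dim (y ` C) \<le> fun_vs.dim ((\<lambda>c q. l c * y c q) ` C)"
      using CE by (intro fun_vs.dim_le_finite) auto
    \<comment> \<open>A nonzero slice of \<open>w\<close> lies in the \<open>y\<close>-spans of both
      \<open>F\<close> and \<open>C\<close>, which saves one dimension and pays for the one lost in
      \<open>dimM\<close>.\<close>
    obtain p where p: "(\<lambda>q. w (p, q)) \<noteq> 0"
      using l(1) unfolding w_def[symmetric] by (auto simp: fun_eq_iff)
    have wFy: "(\<lambda>q. w (p, q)) = (\<Sum>a\<in>F. fscale (k a * x a p) (y a))"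
      by (simp add: fun_eq_iff wFpq sum_fun_apply algebra_simps)
    have wCy: "(\<lambda>q. w (p, q)) = (\<Sum>a\<in>C. fscale (l a * x a p) (y a))"
      by (simp add: fun_eq_iff wCpq sum_fun_apply algebra_simps)
    have "(\<lambda>q. w (p, q)) \<in> fun_vs.span (y ` F)"
      unfolding wFy by (intro fun_vs.span_sum fun_vs.span_scale fun_vs.span_base) auto
    moreover have "(\<lambda>q. w (p, q)) \<in> fun_vs.span (y ` C)"
      unfolding wCy by (intro fun_vs.span_sum fun_vs.span_scale fun_vs.span_base) auto
    ultimately have "fun_vs.dim (y ` F \<union> y ` C) + 1 \<le> fun_vs.dim (y ` F) + fun_vs.dim (y ` C)"
      using CE FE p by (intro fun_vs.dim_Un_le_of_common_vector) auto
    with sx sy dimM F have "good (F \<union> C)"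
      using CE FE unfolding good_def by (auto simp: image_Un)
    from max[OF this] have "card (F \<union> C) \<le> card F" .
    moreover have "card (F \<union> C) = card F + card C"
      using CE FE by (intro card_Un_disjoint) auto
    moreover have "card C > 0" using c0 CE card_gt_0_iff by blast
    ultimately show False by simp
  qed
  then show ?thesis using F by (simp add: good_def)
qed

text \<open>Minimality makes the products of \<open>x\<close> and \<open>y\<close> connected: a
  nonzero slice of a partial sum at a fixed third index lies in the span of the subfamily and, up to
  sign, in that of its complement. So they span at least d1 + d2 - 1 dimensions, and Sylvester's
  inequality applied to the vanishing sum bounds this dimension plus d3 by
  \<open>card E\<close>.\<close>

lemma dims_le_of_minimal_zero_sum:
  fixes x :: "'e \<Rightarrow> 'p \<Rightarrow> 'k::field" and y :: "'e \<Rightarrow> 'q \<Rightarrow> 'k" and z :: "'e \<Rightarrow> 's \<Rightarrow> 'k"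
  assumes "finite E" "E \<noteq> {}"
    and zero: "\<And>p q s. (\<Sum>a\<in>E. x a p * y a q * z a s) = 0"
    and minimal: "\<And>F. F \<noteq> {} \<Longrightarrow> F \<subset> E \<Longrightarrow> \<exists>p q s. (\<Sum>a\<in>F. x a p * y a q * z a s) \<noteq> 0"
  shows "fun_vs.dim (x ` E) + fun_vs.dim (y ` E) + fun_vs.dim (z ` E) \<le> card E + 1"
proof -
  define M where "M = (\<lambda>a. outer (x a) (y a))"
  have "\<exists>w. w \<noteq> 0 \<and> w \<in> fun_vs.span (M ` F) \<and> w \<in> fun_vs.span (M ` (E - F))"
    if F: "F \<noteq> {}" "F \<subset> E" for F
  proof -
    obtain p q s where nz: "(\<Sum>a\<in>F. x a p * y a q * z a s) \<noteq> 0"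
      using minimal[OF F] by blast
    define w where "w = (\<Sum>a\<in>F. fscale (z a s) (M a))"
    have "w (p, q) \<noteq> 0" using nz by (simp add: w_def M_def sum_fun_apply algebra_simps)
    then have "w \<noteq> 0" by (metis zero_fun_apply)
    moreover have "w \<in> fun_vs.span (M ` F)"
      unfolding w_def by (intro fun_vs.span_sum fun_vs.span_scale fun_vs.span_base) auto
    moreover have w: "w = - (\<Sum>a\<in>E - F. fscale (z a s) (M a))"
    proof
      fix pq :: "'p \<times> 'q"
      obtain p q where pq: "pq = (p, q)" by (cases pq)
      show "w pq = (- (\<Sum>a\<in>E - F. fscale (z a s) (M a))) pq"
        using zero[of p q s] sum.subset_diff[of F E "\<lambda>a. z a s * (x a p * y a q)"] F assms(1)
        by (simp add: pq w_def M_def sum_fun_apply algebra_simps eq_neg_iff_add_eq_0)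
    qed
    have "w \<in> fun_vs.span (M ` (E - F))"
      unfolding w
      by (intro fun_vs.span_neg fun_vs.span_sum fun_vs.span_scale fun_vs.span_base) auto
    ultimately show ?thesis by blast
  qed
  then have "fun_vs.dim (x ` E) + fun_vs.dim (y ` E) \<le> fun_vs.dim (M ` E) + 1"
    unfolding M_def using assms(1,2) by (intro dim_outer_ge_of_connected) auto
  moreover have "(\<Sum>c\<in>E. fscale (z c s) (M c)) = 0" for s
    using zero[of _ _ s] by (auto simp: fun_eq_iff sum_fun_apply M_def algebra_simps)
  then have "fun_vs.dim ({} \<union> M ` E) + fun_vs.dim (z ` E) \<le> fun_vs.dim ({} :: ('p \<times> 'q \<Rightarrow> 'k) set) + card E"
    using assms(1) by (intro sylvester_mod) auto
  moreover have "fun_vs.dim ({} :: ('p \<times> 'q \<Rightarrow> 'k) set) = 0"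
    using fun_vs.dim_le_card[of "{}" "{}"] by simp
  ultimately show ?thesis by simp
qed

text \<open>If a subsum vanishes, so does its complement, and by additivity one of the two again has
  nonnegative weight. The weight will count given terms against competing ones.\<close>

lemma exists_minimal_zero_sum:
  fixes f :: "'e \<Rightarrow> 'v::ab_group_add" and s :: "'e \<Rightarrow> int"
  assumes "finite E" "E \<noteq> {}" "sum f E = 0" "sum s E \<ge> 0"
  shows "\<exists>F\<subseteq>E. F \<noteq> {} \<and> sum f F = 0 \<and> sum s F \<ge> 0 \<and>
           (\<forall>F'. F' \<noteq> {} \<longrightarrow> F' \<subset> F \<longrightarrow> sum f F' \<noteq> 0)"
  using assms
proof (induction "card E" arbitrary: E rule: less_induct)
  case less
  show ?case
  proof (cases "\<exists>F'. F' \<noteq> {} \<and> F' \<subset> E \<and> sum f F' = 0")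
    case False
    then show ?thesis using less.prems by (intro exI[of _ E]) auto
  next
    case True
    then obtain F' where F': "F' \<noteq> {}" "F' \<subset> E" "sum f F' = 0" by blast
    have "sum f (E - F') = 0" "sum s E = sum s (E - F') + sum s F'"
      using F' less.prems sum.subset_diff[of F' E f] sum.subset_diff[of F' E s] by auto
    then consider "sum s F' \<ge> 0" | "sum s (E - F') \<ge> 0" using less.prems by linarith
    then obtain G where G: "G \<subset> E" "G \<noteq> {}" "sum f G = 0" "sum s G \<ge> 0"
      using F' \<open>sum f (E - F') = 0\<close> by (cases) (blast, blast)
    have "card G < card E" using G less.prems by (simp add: psubset_card_mono)
    from less.hyps[OF this _ G(2-4)] show ?thesis
      using G less.prems by (meson finite_subset psubset_imp_subset subset_trans)
  qed
qed

text \<open>Kruskal's theorem, with the Kruskal ranks replaced by dimensions of subfamilies as in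
  Lovitz and Petrov.\<close>
theorem kruskal_uniqueness:
  fixes x :: "'e \<Rightarrow> 'p \<Rightarrow> 'k::field" and y :: "'e \<Rightarrow> 'q \<Rightarrow> 'k" and z :: "'e \<Rightarrow> 's \<Rightarrow> 'k"
  assumes "finite A" "finite B" "A \<inter> B = {}" "card B \<le> card A"
    and "\<And>a. a \<in> A \<Longrightarrow> \<exists>p q s. x a p * y a q * z a s \<noteq> 0"
    and "\<And>A'. A' \<subseteq> A \<Longrightarrow> card A' \<ge> 2 \<Longrightarrow>
           2 * card A' + 2 \<le> fun_vs.dim (x ` A') + fun_vs.dim (y ` A') + fun_vs.dim (z ` A')"
    and "\<And>p q s. (\<Sum>a\<in>A. x a p * y a q * z a s) = (\<Sum>b\<in>B. x b p * y b q * z b s)"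
  shows "\<exists>\<beta>. bij_betw \<beta> A B \<and>
           (\<forall>a\<in>A. \<forall>p q s. x a p * y a q * z a s = x (\<beta> a) p * y (\<beta> a) q * z (\<beta> a) s)"
  using assms
proof (induction "card A" arbitrary: A B rule: less_induct)
  case less
  note finA = less.prems(1) and finB = less.prems(2) and disj = less.prems(3)
  show ?case
  proof (cases "A = {}")
    case True
    then have "B = {}" using less.prems by simp
    with True show ?thesis by (simp add: bij_betw_def)
  next
    case False
    \<comment> \<open>The sign occurs twice: in the field it turns the equality of decompositions
      into a vanishing sum, and as the integer \<open>\<epsilon>\<close> it counts members of
      \<open>A\<close> against members of \<open>B\<close>.\<close>
    define sg :: "'e \<Rightarrow> 'k" where "sg a = (if a \<in> A then 1 else - 1)" for a
    define f where "f a = (\<lambda>(p, q, s). sg a * (x a p * y a q * z a s))" for a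
    define \<epsilon> :: "'e \<Rightarrow> int" where "\<epsilon> a = (if a \<in> A then 1 else - 1)" for a
    have onB: "a \<notin> A" if "a \<in> B" for a using that disj by blast
    have sumf: "sum f F (p, q, s) = (\<Sum>a\<in>F. sg a * (x a p * y a q * z a s))" for F p q s
      by (simp add: sum_fun_apply f_def)
    have split: "sum g (A \<union> B) = sum g A + sum g B" for g :: "'e \<Rightarrow> 'v::comm_monoid_add"
      using finA finB disj by (rule sum.union_disjoint)
    have "sum f (A \<union> B) = 0"
    proof
      fix w :: "'p \<times> 'q \<times> 's"
      obtain p q s where w: "w = (p, q, s)" by (cases w)
      have "(\<Sum>a\<in>B. sg a * (x a p * y a q * z a s)) = - (\<Sum>a\<in>B. x a p * y a q * z a s)"
        unfolding sum_negf[symmetric] using onB by (intro sum.cong) (auto simp: sg_def)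
      moreover have "(\<Sum>a\<in>A. sg a * (x a p * y a q * z a s)) = (\<Sum>a\<in>A. x a p * y a q * z a s)"
        by (intro sum.cong) (auto simp: sg_def)
      ultimately show "sum f (A \<union> B) w = 0 w"
        using less.prems(7)[of p q s] by (simp add: w sumf split)
    qed
    moreover have "sum \<epsilon> (A \<union> B) \<ge> 0"
    proof -
      have "sum \<epsilon> B = (\<Sum>a\<in>B. - 1)" using onB by (intro sum.cong) (auto simp: \<epsilon>_def)
      moreover have "sum \<epsilon> A = (\<Sum>a\<in>A. 1)" by (intro sum.cong) (auto simp: \<epsilon>_def)
      ultimately show ?thesis using less.prems(4) by (simp add: split)
    qed
    ultimately obtain F where F: "F \<subseteq> A \<union> B" "F \<noteq> {}" "sum f F = 0" "sum \<epsilon> F \<ge> 0"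
      "\<And>F'. F' \<noteq> {} \<Longrightarrow> F' \<subset> F \<Longrightarrow> sum f F' \<noteq> 0"
      using exists_minimal_zero_sum[of "A \<union> B" f \<epsilon>] finA finB False by auto
    have FAB: "F = (F \<inter> A) \<union> (F \<inter> B)" "finite F" using F(1) finA finB finite_subset by auto
    have splitF: "sum g F = sum g (F \<inter> A) + sum g (F \<inter> B)" for g :: "'e \<Rightarrow> 'v::comm_monoid_add"
      using finA finB disj by (subst FAB(1), intro sum.union_disjoint) auto
    have "sum \<epsilon> (F \<inter> B) = (\<Sum>a\<in>F \<inter> B. - 1)" using onB by (intro sum.cong) (auto simp: \<epsilon>_def)
    moreover have "sum \<epsilon> (F \<inter> A) = (\<Sum>a\<in>F \<inter> A. 1)" by (intro sum.cong) (auto simp: \<epsilon>_def)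
    ultimately have cardFB: "card (F \<inter> B) \<le> card (F \<inter> A)" using F(4) by (simp add: splitF)
    have cardF: "card F = card (F \<inter> A) + card (F \<inter> B)"
      using splitF[of "\<lambda>_. 1::nat"] by simp
    \<comment> \<open>With p members from \<open>A\<close>, the set \<open>F\<close> has at most 2p
      elements and its dimensions add up to at most 2p + 1, against the assumed 2p + 2. The sign is
      absorbed into \<open>x'\<close>, which agrees with \<open>x\<close> on
      \<open>A\<close>.\<close>
    have "card (F \<inter> A) < 2"
    proof (rule ccontr)
      assume big: "\<not> card (F \<inter> A) < 2"
      define x' where "x' a p = sg a * x a p" for a p
      have "fun_vs.dim (x' ` F) + fun_vs.dim (y ` F) + fun_vs.dim (z ` F) \<le> card F + 1"
      proof (intro dims_le_of_minimal_zero_sum FAB F(2))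
        show "(\<Sum>a\<in>F. x' a p * y a q * z a s) = 0" for p q s
          using arg_cong[OF F(3), of "\<lambda>g. g (p, q, s)"] by (simp add: sumf x'_def algebra_simps)
        fix F' assume "F' \<noteq> {}" "F' \<subset> F"
        then have "sum f F' \<noteq> 0" by (rule F(5))
        then obtain p q s where "sum f F' (p, q, s) \<noteq> 0" by (auto simp: fun_eq_iff)
        then show "\<exists>p q s. (\<Sum>a\<in>F'. x' a p * y a q * z a s) \<noteq> 0"
          by (auto simp: sumf x'_def algebra_simps)
      qed
      moreover have "fun_vs.dim (x ` (F \<inter> A)) \<le> fun_vs.dim (x' ` F)"
      proof -
        have "x ` (F \<inter> A) = x' ` (F \<inter> A)" by (intro image_cong) (auto simp: x'_def sg_def)
        then show ?thesis using FAB(2)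
          by (intro fun_vs.dim_le_finite) (auto intro: fun_vs.span_base)
      qed
      moreover have "fun_vs.dim (y ` (F \<inter> A)) \<le> fun_vs.dim (y ` F)"
        "fun_vs.dim (z ` (F \<inter> A)) \<le> fun_vs.dim (z ` F)"
        using FAB(2) by (auto intro!: fun_vs.dim_le_finite intro: fun_vs.span_base)
      moreover have "2 * card (F \<inter> A) + 2 \<le>
          fun_vs.dim (x ` (F \<inter> A)) + fun_vs.dim (y ` (F \<inter> A)) + fun_vs.dim (z ` (F \<inter> A))"
        using big by (intro less.prems(6)) auto
      ultimately show False using cardF cardFB by linarith
    qed
    moreover have "card (F \<inter> A) \<noteq> 0"
      using cardF cardFB F(2) FAB(2) by (metis add_0 card_0_eq le_zero_eq)
    ultimately have "card (F \<inter> A) = 1" by linarith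
    then obtain a where a: "F \<inter> A = {a}" by (rule card_1_singletonE)
    have sum0: "x a p * y a q * z a s = (\<Sum>b\<in>F \<inter> B. x b p * y b q * z b s)" for p q s
    proof -
      have "(\<Sum>c\<in>F \<inter> B. sg c * (x c p * y c q * z c s)) = - (\<Sum>c\<in>F \<inter> B. x c p * y c q * z c s)"
        unfolding sum_negf[symmetric] using onB by (intro sum.cong) (auto simp: sg_def)
      moreover have "sg a = 1" using a by (auto simp: sg_def)
      moreover have "(\<Sum>c\<in>F. sg c * (x c p * y c q * z c s)) = 0"
        using arg_cong[OF F(3), of "\<lambda>g. g (p, q, s)"] by (simp add: sumf)
      ultimately show ?thesis by (simp add: splitF a)
    qed
    \<comment> \<open>The product at \<open>a\<close> is nonzero and so needs a partner;
      \<open>F\<close> is then a pair with equal products, which the induction removes.\<close>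
    have "F \<inter> B \<noteq> {}"
    proof
      assume "F \<inter> B = {}"
      then have "x a p * y a q * z a s = 0" for p q s using sum0[of p q s] by simp
      moreover have "a \<in> A" using a by blast
      ultimately show False using less.prems(5)[of a] by blast
    qed
    moreover have "card (F \<inter> B) \<le> 1" using cardFB a by simp
    moreover have "finite (F \<inter> B)" using finB by simp
    ultimately have "card (F \<inter> B) = 1" by (metis card_0_eq le_neq_implies_less less_one)
    then obtain b where b: "F \<inter> B = {b}" by (rule card_1_singletonE)
    have ab: "a \<in> A" "b \<in> B" using a b by auto
    have eq: "x a p * y a q * z a s = x b p * y b q * z b s" for p q s
      using sum0 b by simp
    have lt: "card (A - {a}) < card A" using ab finA by (meson card_Diff1_less)
    have "\<exists>\<beta>. bij_betw \<beta> (A - {a}) (B - {b}) \<and>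
        (\<forall>c\<in>A - {a}. \<forall>p q s. x c p * y c q * z c s = x (\<beta> c) p * y (\<beta> c) q * z (\<beta> c) s)"
    proof (rule less.hyps[OF lt])
      show "(\<Sum>c\<in>A - {a}. x c p * y c q * z c s) = (\<Sum>c\<in>B - {b}. x c p * y c q * z c s)" for p q s
        using less.prems(7)[of p q s] eq[of p q s]
          sum.remove[OF finA ab(1), of "\<lambda>c. x c p * y c q * z c s"]
          sum.remove[OF finB ab(2), of "\<lambda>c. x c p * y c q * z c s"] by simp
      show "card (B - {b}) \<le> card (A - {a})"
        using ab finA finB less.prems(4) by (simp add: card_Diff_singleton_if)
      show "2 * card A' + 2 \<le> fun_vs.dim (x ` A') + fun_vs.dim (y ` A') + fun_vs.dim (z ` A')"
        if "A' \<subseteq> A - {a}" "card A' \<ge> 2" for A'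
        using that by (intro less.prems(6)) auto
    qed (use finA finB disj less.prems(5) in auto)
    then obtain \<beta> where \<beta>: "bij_betw \<beta> (A - {a}) (B - {b})"
      "\<And>c p q s. c \<in> A - {a} \<Longrightarrow> x c p * y c q * z c s = x (\<beta> c) p * y (\<beta> c) q * z (\<beta> c) s"
      by blast
    have "bij_betw (\<beta>(a := b)) (A - {a}) (B - {b})"
      using \<beta>(1) by (subst bij_betw_cong[of _ _ \<beta>]) auto
    then have "bij_betw (\<beta>(a := b)) (insert a (A - {a})) (insert b (B - {b}))"
      using notIn_Un_bij_betw[of a "A - {a}" "\<beta>(a := b)" "B - {b}"] by simp
    then have "bij_betw (\<beta>(a := b)) A B" using ab by (simp add: insert_absorb)
    moreover have "\<forall>c\<in>A. \<forall>p q s. x c p * y c q * z c s =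
        x ((\<beta>(a := b)) c) p * y ((\<beta>(a := b)) c) q * z ((\<beta>(a := b)) c) s"
      using \<beta>(2) eq by auto
    ultimately show ?thesis by blast
  qed
qed

section \<open>Grids and Zariski open conditions\<close>

lemma PiE_fun_upd_same:
  "i \<in> (\<Pi>\<^sub>E k\<in>K. X k) \<Longrightarrow> k \<in> K \<Longrightarrow> a \<in> X k \<Longrightarrow> i(k := a) \<in> (\<Pi>\<^sub>E k\<in>K. X k)"
  by (auto simp: PiE_iff extensional_def)

lemma PiE_eq_of_invariant_upd:
  fixes g :: "('i \<Rightarrow> 'a) \<Rightarrow> 'v"
  assumes "finite L" "L \<subseteq> K"
    and inv: "\<And>i l b. i \<in> (\<Pi>\<^sub>E k\<in>K. X k) \<Longrightarrow> l \<in> L \<Longrightarrow> b \<in> X l \<Longrightarrow> g (i(l := b)) = g i"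
    and "i \<in> (\<Pi>\<^sub>E k\<in>K. X k)" "i' \<in> (\<Pi>\<^sub>E k\<in>K. X k)" "\<And>k. k \<in> K - L \<Longrightarrow> i k = i' k"
  shows "g i = g i'"
proof -
  have "override_on i i' L' \<in> (\<Pi>\<^sub>E k\<in>K. X k) \<and> g (override_on i i' L') = g i"
    if "finite L'" "L' \<subseteq> L" for L'
    using that
  proof (induction L' rule: finite_induct)
    case empty
    then show ?case using assms(4) by simp
  next
    case (insert l L')
    then have IH: "override_on i i' L' \<in> (\<Pi>\<^sub>E k\<in>K. X k)" "g (override_on i i' L') = g i" by auto
    have l: "l \<in> L" "l \<in> K" "i' l \<in> X l" using insert.prems assms(2,5) by auto
    have "override_on i i' (insert l L') = (override_on i i' L')(l := i' l)"
      by (auto simp: override_on_def)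
    then show ?case using IH inv[OF IH(1) l(1,3)] PiE_fun_upd_same[OF IH(1) l(2,3)]
      by (simp only:)
  qed
  from this[OF assms(1) subset_refl] have "g (override_on i i' L) = g i" by simp
  moreover have "override_on i i' L = i'"
  proof
    fix k show "override_on i i' L k = i' k"
      using assms by (cases "k \<in> K") (auto simp: override_on_def PiE_iff extensional_def)
  qed
  ultimately show ?thesis by simp
qed

text \<open>Say that the coordinate \<open>k\<close> influences \<open>c\<close> if changing \<open>i k\<close> can change \<open>\<sigma> i c\<close>. The exchange
  property makes the sets of coordinates influenced by distinct \<open>k\<close> disjoint; being \<open>m\<close> nonempty
  subsets of an \<open>m\<close>-element set, they are singletons.\<close>
lemma grid_bijection_of_exchange:
  fixes \<sigma> :: "(nat \<Rightarrow> nat) \<Rightarrow> nat \<Rightarrow> nat" and r :: "nat \<Rightarrow> nat" and m :: nat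
  defines "G \<equiv> \<Pi>\<^sub>E k\<in>{1..m}. {1..r k}"
  assumes r: "\<And>k. k \<in> {1..m} \<Longrightarrow> r k \<ge> 2"
    and inj: "inj_on \<sigma> G" and maps: "\<And>i. i \<in> G \<Longrightarrow> \<sigma> i \<in> G"
    and exch: "\<And>i k l a b c. i \<in> G \<Longrightarrow> k \<in> {1..m} \<Longrightarrow> l \<in> {1..m} \<Longrightarrow> k \<noteq> l \<Longrightarrow> a \<in> {1..r k} \<Longrightarrow>
        b \<in> {1..r l} \<Longrightarrow> c \<in> {1..m} \<Longrightarrow>
        \<sigma> i c = \<sigma> (i(k := a)) c \<and> \<sigma> (i(l := b)) c = \<sigma> (i(k := a, l := b)) c \<or>
        \<sigma> i c = \<sigma> (i(l := b)) c \<and> \<sigma> (i(k := a)) c = \<sigma> (i(k := a, l := b)) c"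
  shows "\<exists>\<psi> \<pi>. \<psi> permutes {1..m} \<and> (\<forall>k\<in>{1..m}. r (\<psi> k) = r k) \<and>
           (\<forall>k\<in>{1..m}. \<pi> k permutes {1..r k}) \<and>
           (\<forall>i\<in>G. \<forall>k\<in>{1..m}. \<sigma> i (\<psi> k) = \<pi> k (i k))"
proof -
  define infl where "infl k c \<longleftrightarrow> (\<exists>i\<in>G. \<exists>a\<in>{1..r k}. \<sigma> (i(k := a)) c \<noteq> \<sigma> i c)" for k c
  have upd: "i(k := a) \<in> G" if "i \<in> G" "k \<in> {1..m}" "a \<in> {1..r k}" for i k a
    using that unfolding G_def by (rule PiE_fun_upd_same)
  \<comment> \<open>On a rectangle either both sides in direction \<open>k\<close> are constant or
    the values agree across direction \<open>l\<close>. In both cases, whether setting coordinate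
    \<open>k\<close> to \<open>a\<close> changes the value at \<open>c\<close> is unaffected by
    moving \<open>l\<close>, so it depends only on the old coordinate \<open>k\<close>.\<close>
  have propagate: "(\<sigma> (i(k := a)) c \<noteq> \<sigma> i c) = (\<sigma> (i'(k := a)) c \<noteq> \<sigma> i' c)"
    if "k \<in> {1..m}" "a \<in> {1..r k}" "c \<in> {1..m}" "i \<in> G" "i' \<in> G" "i k = i' k" for i i' k a c
  proof (rule PiE_eq_of_invariant_upd[where L = "{1..m} - {k}" and K = "{1..m}" and X = "\<lambda>k. {1..r k}"
        and g = "\<lambda>i. \<sigma> (i(k := a)) c \<noteq> \<sigma> i c"])
    fix j l b assume j: "j \<in> (\<Pi>\<^sub>E k\<in>{1..m}. {1..r k})" "l \<in> {1..m} - {k}" "b \<in> {1..r l}"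
    then have "(j(k := a, l := b)) = (j(l := b, k := a))" by (auto simp: fun_upd_twist)
    then show "(\<sigma> (j(l := b, k := a)) c \<noteq> \<sigma> (j(l := b)) c) = (\<sigma> (j(k := a)) c \<noteq> \<sigma> j c)"
      using exch[of j k l a b c] j that by (auto simp: G_def)
  qed (use that in \<open>auto simp: G_def\<close>)
  have disj: False if inf: "infl k c" "infl l c" and kl: "k \<noteq> l" "k \<in> {1..m}" "l \<in> {1..m}" "c \<in> {1..m}" for k l c
  proof -
    obtain i a where i: "i \<in> G" "a \<in> {1..r k}" "\<sigma> (i(k := a)) c \<noteq> \<sigma> i c"
      using inf(1) by (auto simp: infl_def)
    obtain j b where j: "j \<in> G" "b \<in> {1..r l}" "\<sigma> (j(l := b)) c \<noteq> \<sigma> j c"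
      using inf(2) by (auto simp: infl_def)
    have ik: "i k \<in> {1..r k}" using i(1) kl(2) by (auto simp: G_def)
    \<comment> \<open>Both influences are brought to one point: \<open>h\<close> agrees with
      \<open>i\<close> at \<open>k\<close> and with \<open>j\<close> at \<open>l\<close>. The
      exchange property at \<open>h\<close> forbids two effective changes.\<close>
    define h where "h = j(k := i k)"
    have h: "h \<in> G" using upd[OF j(1) kl(2) ik] by (simp add: h_def)
    have "\<sigma> (h(l := b)) c \<noteq> \<sigma> h c"
      using propagate[OF kl(3) j(2) kl(4) j(1) h] j(3) kl(1) by (simp add: h_def)
    moreover have "\<sigma> (h(k := a)) c \<noteq> \<sigma> h c"
      using propagate[OF kl(2) i(2) kl(4) i(1) h] i(3) by (simp add: h_def)
    ultimately show False
      using exch[OF h kl(2,3,1) i(2) j(2) kl(4)] by auto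
  qed
  define i0 where "i0 = (\<lambda>k\<in>{1..m}. 1::nat)"
  have i0: "i0 \<in> G" using r by (force simp: i0_def G_def)
  have ext: "\<exists>c\<in>{1..m}. \<sigma> i c \<noteq> \<sigma> j c" if "i \<in> G" "j \<in> G" "i \<noteq> j" for i j
  proof (rule ccontr)
    assume "\<not> ?thesis"
    then have "\<sigma> i = \<sigma> j" using maps[OF that(1)] maps[OF that(2)]
      unfolding G_def by (intro PiE_ext) auto
    then show False using inj that by (auto dest: inj_onD)
  qed
  have "\<exists>c\<in>{1..m}. infl k c" if "k \<in> {1..m}" for k
  proof -
    have "2 \<in> {1..r k}" using r[OF that] by auto
    then have "i0(k := 2) \<in> G" using upd[OF i0 that] by blast
    moreover have "i0(k := 2) \<noteq> i0" using that by (auto simp: i0_def fun_eq_iff)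
    ultimately obtain c where "c \<in> {1..m}" "\<sigma> (i0(k := 2)) c \<noteq> \<sigma> i0 c" using ext i0 by blast
    then show ?thesis using \<open>2 \<in> {1..r k}\<close> i0 unfolding infl_def by blast
  qed
  then obtain \<phi> where \<phi>: "\<And>k. k \<in> {1..m} \<Longrightarrow> \<phi> k \<in> {1..m} \<and> infl k (\<phi> k)" by metis
  have "inj_on \<phi> {1..m}"
    using \<phi> disj by (auto intro!: inj_onI) (metis atLeastAtMost_iff)
  moreover have "\<phi> ` {1..m} \<subseteq> {1..m}" using \<phi> by blast
  ultimately have bij\<phi>: "bij_betw \<phi> {1..m} {1..m}"
    by (simp add: bij_betw_def endo_inj_surj)
  have indep: "\<sigma> i (\<phi> k) = \<sigma> j (\<phi> k)" if "k \<in> {1..m}" "i \<in> G" "j \<in> G" "i k = j k" for i j k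
  proof (rule PiE_eq_of_invariant_upd[where L = "{1..m} - {k}" and K = "{1..m}" and X = "\<lambda>k. {1..r k}"
        and g = "\<lambda>i. \<sigma> i (\<phi> k)"])
    fix h l b assume h: "h \<in> (\<Pi>\<^sub>E k\<in>{1..m}. {1..r k})" "l \<in> {1..m} - {k}" "b \<in> {1..r l}"
    then have "\<not> infl l (\<phi> k)" using disj[of k "\<phi> k" l] \<phi>[OF that(1)] that(1) by auto
    then show "\<sigma> (h(l := b)) (\<phi> k) = \<sigma> h (\<phi> k)" using h unfolding infl_def G_def by blast
  qed (use that in \<open>auto simp: G_def\<close>)
  define g where "g k u = \<sigma> (i0(k := u)) (\<phi> k)" for k u
  have \<sigma>g: "\<sigma> i (\<phi> k) = g k (i k)" if "i \<in> G" "k \<in> {1..m}" for i k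
  proof -
    have "i k \<in> {1..r k}" using that by (auto simp: G_def)
    then show ?thesis unfolding g_def using that upd[OF i0] by (intro indep) auto
  qed
  have gmaps: "g k ` {1..r k} \<subseteq> {1..r (\<phi> k)}" if "k \<in> {1..m}" for k
    using maps[OF upd[OF i0 that]] \<phi>[OF that] by (auto simp: g_def G_def PiE_iff)
  have ginj: "inj_on (g k) {1..r k}" if k: "k \<in> {1..m}" for k
  proof (rule inj_onI, rule ccontr)
    fix u v assume uv: "u \<in> {1..r k}" "v \<in> {1..r k}" "g k u = g k v" "u \<noteq> v"
    have "i0(k := u) \<noteq> i0(k := v)" using uv(4) by (metis fun_upd_same)
    then obtain c where c: "c \<in> {1..m}" "\<sigma> (i0(k := u)) c \<noteq> \<sigma> (i0(k := v)) c"
      using ext upd[OF i0 k] uv by blast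
    obtain l where l: "l \<in> {1..m}" "c = \<phi> l" using c(1) bij\<phi> unfolding bij_betw_def by blast
    have "\<sigma> (i0(k := u)) (\<phi> l) = \<sigma> (i0(k := v)) (\<phi> l)"
      using uv \<sigma>g[OF upd[OF i0 k uv(1)] l(1)] \<sigma>g[OF upd[OF i0 k uv(2)] l(1)] by (cases "l = k") auto
    then show False using c l by simp
  qed
  have le: "r k \<le> r (\<phi> k)" if "k \<in> {1..m}" for k
    using card_inj_on_le[OF ginj gmaps] that by simp
  \<comment> \<open>Injectivity of \<open>g k\<close> gives only an inequality; summing over the
    bijection \<open>\<phi>\<close> leaves no room for a strict one.\<close>
  have req: "r (\<phi> k) = r k" if "k \<in> {1..m}" for k
  proof (rule ccontr)
    assume "r (\<phi> k) \<noteq> r k"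
    then have "(\<Sum>k\<in>{1..m}. r k) < (\<Sum>k\<in>{1..m}. r (\<phi> k))"
      using le that by (intro sum_strict_mono_ex1) (auto intro!: bexI[of _ k] simp: order.strict_iff_order)
    then show False using sum.reindex_bij_betw[OF bij\<phi>, of r] by simp
  qed
  define \<psi> where "\<psi> k = (if k \<in> {1..m} then \<phi> k else k)" for k
  define \<pi> where "\<pi> k u = (if u \<in> {1..r k} then g k u else u)" for k u
  have "\<psi> permutes {1..m}"
  proof (rule bij_imp_permutes)
    show "bij_betw \<psi> {1..m} {1..m}"
      using bij\<phi> by (subst bij_betw_cong[of _ _ \<phi>]) (auto simp: \<psi>_def)
  qed (auto simp: \<psi>_def)
  moreover have "\<pi> k permutes {1..r k}" if "k \<in> {1..m}" for k
  proof (rule bij_imp_permutes)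
    have "bij_betw (g k) {1..r k} {1..r k}"
      using ginj[OF that] gmaps[OF that] req[OF that] by (simp add: bij_betw_def endo_inj_surj)
    then show "bij_betw (\<pi> k) {1..r k} {1..r k}"
      by (subst bij_betw_cong[of _ _ "g k"]) (auto simp: \<pi>_def)
  qed (auto simp: \<pi>_def)
  moreover have "\<sigma> i (\<psi> k) = \<pi> k (i k)" if "i \<in> G" "k \<in> {1..m}" for i k
  proof -
    have "i k \<in> {1..r k}" using that by (auto simp: G_def)
    then show ?thesis using \<sigma>g[OF that] that(2) by (simp add: \<psi>_def \<pi>_def)
  qed
  moreover have "r (\<psi> k) = r k" if "k \<in> {1..m}" for k using req that by (simp add: \<psi>_def)
  ultimately show ?thesis by blast
qed

text \<open>Zariski open conditions that hold at \<open>A0\<close>. A single common witness \<open>A0\<close> makes their finite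
  intersections nonempty without any appeal to irreducibility.\<close>
definition open_around ::
  "('p \<Rightarrow> 'k::comm_ring_1) set \<Rightarrow> 'p \<Rightarrow> ('p \<Rightarrow> bool) \<Rightarrow> bool" where
  "open_around X A0 Q \<longleftrightarrow> (\<exists>f\<in>polynomial_functions X. f A0 \<noteq> 0 \<and> (\<forall>A. f A \<noteq> 0 \<longrightarrow> Q A))"

lemma open_around_mono: "open_around X A0 Q \<Longrightarrow> (\<And>A. Q A \<Longrightarrow> Q' A) \<Longrightarrow> open_around X A0 Q'"
  unfolding open_around_def by blast

lemma open_around_poly:
  "f \<in> polynomial_functions X \<Longrightarrow> f A0 \<noteq> 0 \<Longrightarrow> open_around X A0 (\<lambda>A. f A \<noteq> 0)"
  unfolding open_around_def by blast

lemma open_around_conj: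
  fixes X :: "('p \<Rightarrow> 'k::idom) set"
  assumes "open_around X A0 Q" "open_around X A0 Q'"
  shows "open_around X A0 (\<lambda>A. Q A \<and> Q' A)"
proof -
  obtain f g where f: "f \<in> polynomial_functions X" "f A0 \<noteq> 0" "\<And>A. f A \<noteq> 0 \<Longrightarrow> Q A"
    and g: "g \<in> polynomial_functions X" "g A0 \<noteq> 0" "\<And>A. g A \<noteq> 0 \<Longrightarrow> Q' A"
    using assms unfolding open_around_def by blast
  show ?thesis unfolding open_around_def
    using f g by (intro bexI[of _ "\<lambda>A. f A * g A"] polynomial_functions.mult) auto
qed

lemma open_around_ball:
  fixes X :: "('p \<Rightarrow> 'k::idom) set"
  assumes "finite S" "\<And>s. s \<in> S \<Longrightarrow> open_around X A0 (Q s)"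
  shows "open_around X A0 (\<lambda>A. \<forall>s\<in>S. Q s A)"
  using assms
proof (induction S rule: finite_induct)
  case empty
  show ?case
    unfolding open_around_def by (intro bexI[of _ "\<lambda>_. 1"] polynomial_functions.const) auto
next
  case (insert s S)
  then have "open_around X A0 (\<lambda>A. Q s A \<and> (\<forall>s\<in>S. Q s A))" by (intro open_around_conj) auto
  then show ?case by (rule open_around_mono) auto
qed

lemma polynomial_functions_prod:
  "(\<And>s. s \<in> S \<Longrightarrow> (\<lambda>A. f s A) \<in> polynomial_functions X) \<Longrightarrow> (\<lambda>A. \<Prod>s\<in>S. f s A) \<in> polynomial_functions X"
  by (induction S rule: infinite_finite_induct)
    (auto intro: polynomial_functions.const polynomial_functions.mult)

lemma polynomial_functions_diff:
  assumes "f \<in> polynomial_functions X" "g \<in> polynomial_functions X"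
  shows "(\<lambda>A. f A - g A) \<in> polynomial_functions X"
proof -
  have "(\<lambda>A. f A + (- 1) * g A) \<in> polynomial_functions X"
    by (intro polynomial_functions.add polynomial_functions.mult polynomial_functions.const assms)
  then show ?thesis by simp
qed

definition columns_independent :: "'q set \<Rightarrow> 'c set \<Rightarrow> ('q \<Rightarrow> 'c \<Rightarrow> 'k::comm_ring_1) \<Rightarrow> bool" where
  "columns_independent Y S M \<longleftrightarrow>
     (\<forall>l. (\<forall>y\<in>Y. (\<Sum>c\<in>S. l c * M y c) = 0) \<longrightarrow> (\<forall>c\<in>S. l c = 0))"

text \<open>One step of Gaussian elimination with a pivot that does not vanish at \<open>A0\<close>.\<close>
lemma open_around_columns_independent:
  fixes M :: "'p \<Rightarrow> 'q \<Rightarrow> 'c \<Rightarrow> 'k::field"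
  assumes "finite S"
    and "\<And>y c. y \<in> Y \<Longrightarrow> c \<in> S \<Longrightarrow> (\<lambda>A. M A y c) \<in> polynomial_functions X"
    and "columns_independent Y S (M A0)"
  shows "open_around X A0 (\<lambda>A. columns_independent Y S (M A))"
  using assms
proof (induction S arbitrary: M rule: finite_induct)
  case empty
  have "open_around X A0 (\<lambda>A. \<forall>s\<in>{}. False)" by (rule open_around_ball) auto
  then show ?case by (rule open_around_mono) (simp add: columns_independent_def)
next
  case (insert c S)
  have upd: "(\<Sum>s\<in>insert c S. (l(c := t)) s * M A y s) = t * M A y c + (\<Sum>s\<in>S. l s * M A y s)" for l t A y
  proof -
    have "(\<Sum>s\<in>S. (l(c := t)) s * M A y s) = (\<Sum>s\<in>S. l s * M A y s)"
      using insert.hyps by (intro sum.cong) auto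
    then show ?thesis using insert.hyps by simp
  qed
  have "\<exists>y0\<in>Y. M A0 y0 c \<noteq> 0"
  proof (rule ccontr)
    assume "\<not> ?thesis"
    then have "\<forall>y\<in>Y. (\<Sum>s\<in>insert c S. ((\<lambda>_. 0)(c := 1)) s * M A0 y s) = 0" by (simp only: upd) simp
    then have "\<forall>s\<in>insert c S. ((\<lambda>_. 0)(c := (1::'k))) s = 0"
      using insert.prems(2) unfolding columns_independent_def by blast
    then show False by simp
  qed
  then obtain y0 where y0: "y0 \<in> Y" "M A0 y0 c \<noteq> 0" by blast
  \<comment> \<open>Elimination without division: the new entries are two-by-two minors through the
    pivot and remain polynomial functions.\<close>
  define N where "N A y s = M A y0 c * M A y s - M A y c * M A y0 s" for A y s
  have sumN: "(\<Sum>s\<in>S. l s * N A y s) =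
      M A y0 c * (\<Sum>s\<in>S. l s * M A y s) - M A y c * (\<Sum>s\<in>S. l s * M A y0 s)" for l A y
    by (simp add: N_def sum_distrib_left right_diff_distrib sum_subtractf algebra_simps)
  have "columns_independent Y S (N A0)"
    unfolding columns_independent_def
  proof (intro allI impI)
    fix l assume l: "\<forall>y\<in>Y. (\<Sum>s\<in>S. l s * N A0 y s) = 0"
    \<comment> \<open>The coefficient at \<open>c\<close> that solves the pivot row, so that a
      dependency of \<open>N\<close> lifts to one of \<open>M\<close>.\<close>
    define t where "t = - (\<Sum>s\<in>S. l s * M A0 y0 s) / M A0 y0 c"
    have "(\<Sum>s\<in>insert c S. (l(c := t)) s * M A0 y s) = 0" if "y \<in> Y" for y
      using l[rule_format, OF that] y0(2) unfolding upd sumN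
      by (simp add: t_def field_simps)
    then have "\<forall>s\<in>insert c S. (l(c := t)) s = 0"
      using insert.prems(2) unfolding columns_independent_def by blast
    then show "\<forall>s\<in>S. l s = 0" using insert.hyps by (metis fun_upd_apply insertCI)
  qed
  moreover have "(\<lambda>A. N A y s) \<in> polynomial_functions X" if "y \<in> Y" "s \<in> S" for y s
    unfolding N_def using that y0 insert.prems(1)
    by (intro polynomial_functions_diff polynomial_functions.mult) auto
  ultimately have "open_around X A0 (\<lambda>A. columns_independent Y S (N A))"
    using insert.IH[of N] by blast
  moreover have "open_around X A0 (\<lambda>A. M A y0 c \<noteq> 0)"
    using insert.prems(1) y0 by (intro open_around_poly) auto
  ultimately have "open_around X A0 (\<lambda>A. columns_independent Y S (N A) \<and> M A y0 c \<noteq> 0)"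
    by (rule open_around_conj)
  then show ?case
  proof (rule open_around_mono)
    fix A assume A: "columns_independent Y S (N A) \<and> M A y0 c \<noteq> 0"
    show "columns_independent Y (insert c S) (M A)"
      unfolding columns_independent_def
    proof (intro allI impI)
      fix l assume l: "\<forall>y\<in>Y. (\<Sum>s\<in>insert c S. l s * M A y s) = 0"
      have eq: "(\<Sum>s\<in>S. l s * M A y s) = - (l c * M A y c)" if "y \<in> Y" for y
        using l[rule_format, OF that] insert.hyps by (simp add: eq_neg_iff_add_eq_0 add.commute)
      have "\<forall>y\<in>Y. (\<Sum>s\<in>S. l s * N A y s) = 0"
        unfolding sumN using eq y0 by simp
      then have "\<forall>s\<in>S. l s = 0" using A unfolding columns_independent_def by blast
      moreover from this have "l c = 0" using eq[OF y0(1)] A by simp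
      ultimately show "\<forall>s\<in>insert c S. l s = 0" by simp
    qed
  qed
qed

text \<open>Subtracting \<open>t c\<close> times one equation from the next removes the term of
  \<open>c\<close> and multiplies the other coefficients by nonzero differences of nodes.\<close>

lemma vandermonde_independent:
  fixes t :: "'c \<Rightarrow> 'k::idom"
  assumes "finite S" "inj_on t S" "\<And>e. e < card S \<Longrightarrow> (\<Sum>c\<in>S. l c * t c ^ e) = 0"
  shows "\<forall>c\<in>S. l c = 0"
  using assms
proof (induction S arbitrary: l rule: finite_induct)
  case (insert c S)
  have "\<forall>s\<in>S. l s * (t s - t c) = 0"
  proof (rule insert.IH)
    fix e assume "e < card S"
    then have "(\<Sum>s\<in>insert c S. l s * t s ^ Suc e) = 0" "(\<Sum>s\<in>insert c S. l s * t s ^ e) = 0"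
      using insert.hyps by (auto intro!: insert.prems(2) simp del: power_Suc sum.insert)
    then have "(\<Sum>s\<in>insert c S. l s * t s ^ Suc e) - t c * (\<Sum>s\<in>insert c S. l s * t s ^ e) = 0"
      by simp
    then have "(\<Sum>s\<in>insert c S. l s * (t s - t c) * t s ^ e) = 0"
      by (simp only: sum_distrib_left sum_subtractf[symmetric]) (simp add: algebra_simps)
    then show "(\<Sum>s\<in>S. l s * (t s - t c) * t s ^ e) = 0" using insert.hyps by simp
  qed (use insert.prems in auto)
  moreover have "t s \<noteq> t c" if "s \<in> S" for s
    using insert.prems(1) insert.hyps that by (metis inj_on_eq_iff insertCI)
  ultimately have "\<forall>s\<in>S. l s = 0" by auto
  moreover from this have "l c = 0" using insert.prems(2)[of 0] insert.hyps by simp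
  ultimately show ?case by simp
qed simp

section \<open>Uniqueness from identifiability\<close>

lemma prod_sum_PiE:
  fixes f :: "'i \<Rightarrow> 'a \<Rightarrow> 'k::comm_semiring_1"
  assumes "finite K"
  shows "(\<Prod>k\<in>K. \<Sum>a\<in>X k. f k a) = (\<Sum>i\<in>(\<Pi>\<^sub>E k\<in>K. X k). \<Prod>k\<in>K. f k (i k))"
  using assms
proof (induction K rule: finite_induct)
  case empty
  then show ?case by simp
next
  case (insert c K)
  have "(\<Sum>i\<in>(\<Pi>\<^sub>E k\<in>insert c K. X k). \<Prod>k\<in>insert c K. f k (i k)) =
      (\<Sum>(y, g)\<in>X c \<times> (\<Pi>\<^sub>E k\<in>K. X k). \<Prod>k\<in>insert c K. f k ((g(c := y)) k))"
    unfolding PiE_insert_eq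
    using inj_combinator[OF insert.hyps(2), of X] by (subst sum.reindex) (auto simp: case_prod_unfold)
  also have "\<dots> = (\<Sum>(y, g)\<in>X c \<times> (\<Pi>\<^sub>E k\<in>K. X k). f c y * (\<Prod>k\<in>K. f k (g k)))"
  proof (intro sum.cong refl, clarify)
    fix y g
    have "(\<Prod>k\<in>K. f k ((g(c := y)) k)) = (\<Prod>k\<in>K. f k (g k))"
      using insert.hyps by (intro prod.cong) auto
    then show "(\<Prod>k\<in>insert c K. f k ((g(c := y)) k)) = f c y * (\<Prod>k\<in>K. f k (g k))"
      using insert.hyps by simp
  qed
  also have "\<dots> = (\<Sum>y\<in>X c. f c y) * (\<Sum>g\<in>(\<Pi>\<^sub>E k\<in>K. X k). \<Prod>k\<in>K. f k (g k))"
    by (simp add: sum_product sum.cartesian_product)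
  finally show ?case using insert by simp
qed

definition grid :: "nat \<Rightarrow> (nat \<Rightarrow> nat) \<Rightarrow> (nat \<Rightarrow> nat) set" where
  "grid m r = (\<Pi>\<^sub>E k\<in>{1..m}. {1..r k})"

lemma finite_grid: "finite (grid m r)"
  unfolding grid_def by (intro finite_PiE) auto

lemma card_grid: "card (grid m r) = (\<Prod>k\<in>{1..m}. r k)"
  unfolding grid_def by (simp add: card_PiE)

lemma grid_through:
  assumes "k \<in> {1..m}" "a \<in> {1..r k}" "\<forall>k\<in>{1..m}. r k \<ge> 2"
  shows "\<exists>i\<in>grid m r. i k = a"
proof
  show "(\<lambda>k'\<in>{1..m}. if k' = k then a else 1) \<in> grid m r"
    using assms by (force simp: grid_def)
qed (use assms in simp)

definition summand :: "nat \<Rightarrow> (nat \<Rightarrow> nat \<Rightarrow> 'k::comm_ring_1 tensor) \<Rightarrow> (nat \<Rightarrow> nat) \<Rightarrow> 'k tensor" where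
  "summand m A i = hadamard_prod {1..m} (\<lambda>k. A k (i k))"

lemma summand_apply: "summand m A i x = (\<Prod>k\<in>{1..m}. A k (i k) x)"
  by (simp add: summand_def hadamard_prod_def)

lemma hadamard_of_sums_eq_sum_summands:
  "hadamard_of_sums m r A = (\<lambda>x. \<Sum>i\<in>grid m r. summand m A i x)"
  by (simp add: hadamard_of_sums_def hadamard_prod_def prod_sum_PiE grid_def summand_apply)

section \<open>Rank-one tensors and their Hadamard products\<close>

definition rank_one_tensor :: "nat \<Rightarrow> (nat \<Rightarrow> nat) \<Rightarrow> (nat \<Rightarrow> nat \<Rightarrow> 'k::comm_ring_1) \<Rightarrow> 'k tensor" where
  "rank_one_tensor d n a = (\<lambda>x. if x \<in> multi_indices d n then \<Prod>j\<in>{1..d}. a j (x j) else 0)"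

lemma rank_one_iff:
  "rank_one d n T \<longleftrightarrow>
     (\<exists>a. (\<forall>j\<in>{1..d}. \<exists>y\<in>{1..n j}. a j y \<noteq> 0) \<and> T = rank_one_tensor d n a)"
  by (simp add: rank_one_def rank_one_tensor_def)

lemma rank_one_eq_0: "rank_one d n T \<Longrightarrow> x \<notin> multi_indices d n \<Longrightarrow> T x = 0"
  by (auto simp: rank_one_iff rank_one_tensor_def)

lemma multi_indices_memD: "x \<in> multi_indices d n \<Longrightarrow> j \<in> {1..d} \<Longrightarrow> x j \<in> {1..n j}"
  by (auto simp: multi_indices_def)

lemma finite_multi_indices: "finite (multi_indices d n)"
  unfolding multi_indices_def by (intro finite_PiE) auto

lemma multi_index_through:
  assumes "\<forall>j\<in>{1..d}. n j \<ge> 1" "j \<in> {1..d}" "y \<in> {1..n j}"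
  shows "\<exists>x\<in>multi_indices d n. x j = y"
proof
  show "(\<lambda>j'\<in>{1..d}. if j' = j then y else 1) \<in> multi_indices d n"
    using assms by (force simp: multi_indices_def)
qed (use assms in simp)

lemma rank_one_tensor_in_segre:
  fixes a :: "nat \<Rightarrow> nat \<Rightarrow> 'k::idom"
  shows "rank_one_tensor d n a \<in> segre d n"
proof (cases "\<forall>j\<in>{1..d}. \<exists>y\<in>{1..n j}. a j y \<noteq> 0")
  case True
  then show ?thesis by (auto simp: segre_def rank_one_iff)
next
  case False
  then obtain j where j: "j \<in> {1..d}" "\<And>y. y \<in> {1..n j} \<Longrightarrow> a j y = 0" by blast
  have "rank_one_tensor d n a x = 0" for x
  proof (cases "x \<in> multi_indices d n")
    case True
    then have "a j (x j) = 0" using j multi_indices_memD by blast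
    then show ?thesis using j(1) by (auto simp: rank_one_tensor_def intro!: prod_zero)
  qed (simp add: rank_one_tensor_def)
  then show ?thesis by (auto simp: segre_def)
qed

lemma rank_one_tensor_factor_nonzero:
  fixes a :: "nat \<Rightarrow> nat \<Rightarrow> 'k::idom"
  assumes "\<forall>j\<in>{1..d}. n j \<ge> 1" "\<forall>x\<in>multi_indices d n. rank_one_tensor d n a x \<noteq> 0"
    and "j \<in> {1..d}" "y \<in> {1..n j}"
  shows "a j y \<noteq> 0"
proof -
  obtain x where x: "x \<in> multi_indices d n" "x j = y"
    using multi_index_through[OF assms(1,3,4)] by blast
  then have "(\<Prod>j\<in>{1..d}. a j (x j)) \<noteq> 0" using assms(2) by (auto simp: rank_one_tensor_def)
  then have "\<forall>j\<in>{1..d}. a j (x j) \<noteq> 0" by simp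
  then show ?thesis using x(2) assms(3) by blast
qed

lemma rank_one_tensor_nonzero_rank_one:
  fixes a :: "nat \<Rightarrow> nat \<Rightarrow> 'k::idom"
  assumes "\<forall>j\<in>{1..d}. n j \<ge> 1" "\<And>j y. j \<in> {1..d} \<Longrightarrow> y \<in> {1..n j} \<Longrightarrow> a j y \<noteq> 0"
  shows "rank_one d n (rank_one_tensor d n a)"
  unfolding rank_one_iff
proof (intro exI conjI ballI refl)
  fix j assume j: "j \<in> {1..d}"
  then have "1 \<in> {1..n j}" using assms(1) by auto
  then show "\<exists>y\<in>{1..n j}. a j y \<noteq> 0" using assms(2)[OF j] by blast
qed simp

text \<open>Hadamard multiplication acts on each factor vector separately. Entrywise products of
  nonzero vectors may vanish, so only membership in the Segre variety can be claimed.\<close>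

lemma summand_in_segre:
  fixes A :: "nat \<Rightarrow> nat \<Rightarrow> 'k::idom tensor"
  assumes "m \<ge> 1" "\<And>k. k \<in> {1..m} \<Longrightarrow> rank_one d n (A k (i k))"
  shows "summand m A i \<in> segre d n"
proof -
  obtain a where a: "\<And>k. k \<in> {1..m} \<Longrightarrow> A k (i k) = rank_one_tensor d n (a k)"
    using assms(2) unfolding rank_one_iff by metis
  have "summand m A i = rank_one_tensor d n (\<lambda>j y. \<Prod>k\<in>{1..m}. a k j y)"
  proof
    fix x
    have "(\<Prod>k\<in>{1..m}. A k (i k) x) = (\<Prod>k\<in>{1..m}. rank_one_tensor d n (a k) x)"
      using a by (intro prod.cong) auto
    also have "\<dots> = rank_one_tensor d n (\<lambda>j y. \<Prod>k\<in>{1..m}. a k j y) x"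
    proof (cases "x \<in> multi_indices d n")
      case True
      then show ?thesis unfolding rank_one_tensor_def by (simp del: One_nat_def) (rule prod.swap)
    next
      case False
      have "1 \<in> {1..m}" using assms(1) by simp
      then show ?thesis using False by (auto simp: rank_one_tensor_def intro!: prod_zero)
    qed
    finally show "summand m A i x = rank_one_tensor d n (\<lambda>j y. \<Prod>k\<in>{1..m}. a k j y) x"
      by (simp add: summand_apply)
  qed
  then show ?thesis by (simp only: rank_one_tensor_in_segre)
qed

lemma rank_one_quotient:
  fixes S T :: "'k::field tensor"
  assumes "\<forall>j\<in>{1..d}. n j \<ge> 1" "rank_one d n S" "rank_one d n T"
    and "\<forall>x\<in>multi_indices d n. S x \<noteq> 0" "\<forall>x\<in>multi_indices d n. T x \<noteq> 0"
  shows "rank_one d n (\<lambda>x. S x / T x)"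
proof -
  obtain s t where s: "S = rank_one_tensor d n s" and t: "T = rank_one_tensor d n t"
    using assms(2,3) by (auto simp: rank_one_iff)
  have "(\<lambda>x. S x / T x) = rank_one_tensor d n (\<lambda>j y. s j y / t j y)"
    by (auto simp: s t rank_one_tensor_def prod_dividef)
  moreover have "s j y / t j y \<noteq> 0" if "j \<in> {1..d}" "y \<in> {1..n j}" for j y
    using rank_one_tensor_factor_nonzero[OF assms(1) _ that] assms(4,5) s t by auto
  ultimately show ?thesis
    using rank_one_tensor_nonzero_rank_one[OF assms(1), of "\<lambda>j y. s j y / t j y"] by simp
qed

lemma tensor_rank_le:
  assumes "finite I" "\<And>i. i \<in> I \<Longrightarrow> B i \<in> segre d n" "T = (\<lambda>x. \<Sum>i\<in>I. B i x)"
  shows "tensor_rank d n T \<le> card I"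
proof -
  define I' where "I' = {i \<in> I. rank_one d n (B i)}"
  have I': "finite I'" "I' \<subseteq> I" using assms(1) by (auto simp: I'_def)
  obtain h where h: "bij_betw h {1..card I'} I'"
    using ex_bij_betw_nat_finite_1[OF I'(1)] by blast
  have "T = (\<lambda>x. \<Sum>i\<in>{1..card I'}. B (h i) x)"
  proof
    fix x
    have "T x = (\<Sum>i\<in>I. B i x)" by (simp add: assms(3))
    also have "\<dots> = (\<Sum>i\<in>I'. B i x)"
    proof (intro sum.mono_neutral_right assms(1) I'(2) ballI)
      fix i assume "i \<in> I - I'"
      then have "B i = (\<lambda>x. 0)" using assms(2)[of i] by (auto simp: I'_def segre_def)
      then show "B i x = 0" by simp
    qed
    also have "\<dots> = (\<Sum>i\<in>{1..card I'}. B (h i) x)"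
      by (rule sum.reindex_bij_betw[OF h, symmetric])
    finally show "T x = (\<Sum>i\<in>{1..card I'}. B (h i) x)" .
  qed
  moreover have "\<forall>i\<in>{1..card I'}. rank_one d n (B (h i))"
    using h by (auto simp: bij_betw_def I'_def)
  ultimately have "tensor_rank d n T \<le> card I'"
    unfolding tensor_rank_def by (intro Least_le exI[of _ "\<lambda>i. B (h i)"]) auto
  then show ?thesis using card_mono[OF assms(1) I'(2)] by linarith
qed

lemma segre_scale_2:
  fixes T :: "'k::field_char_0 tensor"
  assumes "d \<ge> 1" "T \<in> segre d n"
  shows "(\<lambda>x. 2 * T x) \<in> segre d n"
proof -
  consider "T = (\<lambda>x. 0)" | a where "T = rank_one_tensor d n a"
    using assms(2) by (auto simp: segre_def rank_one_iff)
  then show ?thesis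
  proof cases
    case 1
    then show ?thesis by (simp add: segre_def)
  next
    case (2 a)
    have "(\<Prod>j\<in>{1..d}. (if j = 1 then 2 else 1) * a j (x j)) = 2 * (\<Prod>j\<in>{1..d}. a j (x j))" for x
    proof -
      have "(\<Prod>j\<in>{1..d}. (if j = 1 then 2 else 1 :: 'k)) = 2"
        using assms(1) by (simp add: prod.delta)
      then show ?thesis by (simp add: prod.distrib)
    qed
    then have "(\<lambda>x. 2 * T x) = rank_one_tensor d n (\<lambda>j y. (if j = 1 then 2 else 1) * a j y)"
      by (auto simp: 2 rank_one_tensor_def)
    then show ?thesis by (simp only: rank_one_tensor_in_segre)
  qed
qed

text \<open>A zero summand can be deleted and two equal ones merged into twice one of them; either
  would write \<open>T\<close> with fewer than \<open>R\<close> terms and contradict its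
  rank.\<close>

lemma identifiable_summands_distinct:
  fixes T :: "'k::field_char_0 tensor"
  assumes "d \<ge> 1" "identifiable d n R T" "finite I" "card I = R"
    and segre: "\<And>i. i \<in> I \<Longrightarrow> B i \<in> segre d n" and T: "T = (\<lambda>x. \<Sum>i\<in>I. B i x)"
  shows "inj_on B I" and "\<And>i. i \<in> I \<Longrightarrow> rank_one d n (B i)"
proof -
  have rank: "tensor_rank d n T = R" using assms(2) by (simp add: identifiable_def)
  have drop: False if "i \<in> I" "\<And>j. j \<in> I - {i} \<Longrightarrow> C j \<in> segre d n" "T = (\<lambda>x. \<Sum>j\<in>I - {i}. C j x)" for i C
  proof -
    have "tensor_rank d n T \<le> card (I - {i})"
      using assms(3) that by (intro tensor_rank_le) auto
    moreover have "card (I - {i}) < card I" using assms(3) that(1) by (meson card_Diff1_less)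
    ultimately show False using rank assms(4) by simp
  qed
  show "rank_one d n (B i)" if i: "i \<in> I" for i
  proof (rule ccontr)
    assume "\<not> rank_one d n (B i)"
    then have "B i = (\<lambda>x. 0)" using segre[OF i] by (simp add: segre_def)
    then have "T = (\<lambda>x. \<Sum>j\<in>I - {i}. B j x)"
      using i assms(3) by (simp add: T sum.remove[OF _ i])
    then show False using drop[OF i] segre by blast
  qed
  show "inj_on B I"
  proof (rule inj_onI, rule ccontr)
    fix i j assume ij: "i \<in> I" "j \<in> I" "B i = B j" "i \<noteq> j"
    define C where "C = B(i := (\<lambda>x. 2 * B i x))"
    have C: "C k \<in> segre d n" if "k \<in> I - {j}" for k
      using that segre segre_scale_2[OF assms(1)] by (auto simp: C_def)
    have "T x = (\<Sum>k\<in>I - {j}. C k x)" for x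
    proof -
      have "T x = B j x + (B i x + (\<Sum>k\<in>I - {j} - {i}. B k x))"
        using assms(3) ij by (simp add: T sum.remove[OF assms(3) ij(2)] sum.remove[of "I - {j}" i])
      also have "\<dots> = C i x + (\<Sum>k\<in>I - {j} - {i}. C k x)"
        using ij(3) by (simp add: C_def)
      also have "\<dots> = (\<Sum>k\<in>I - {j}. C k x)"
        using assms(3) ij by (intro sum.remove[symmetric]) auto
      finally show ?thesis .
    qed
    then have "T = (\<lambda>x. \<Sum>k\<in>I - {j}. C k x)" by (rule ext)
    then show False using drop[OF ij(2), of C] C by blast
  qed
qed

lemma identifiable_summands_unique:
  fixes T :: "'k::field_char_0 tensor"
  assumes "d \<ge> 1" "identifiable d n R T" "finite I" "card I = R"
    and "\<And>i. i \<in> I \<Longrightarrow> B i \<in> segre d n" "T = (\<lambda>x. \<Sum>i\<in>I. B i x)"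
    and "\<And>i. i \<in> I \<Longrightarrow> C i \<in> segre d n" "T = (\<lambda>x. \<Sum>i\<in>I. C i x)"
  shows "B ` I = C ` I"
proof -
  define P where "P \<B> \<longleftrightarrow> finite \<B> \<and> card \<B> = R \<and> (\<forall>B\<in>\<B>. rank_one d n B) \<and>
    T = (\<lambda>x. \<Sum>B\<in>\<B>. B x)" for \<B>
  have P: "P (D ` I)"
    if D: "\<And>i. i \<in> I \<Longrightarrow> D i \<in> segre d n" "T = (\<lambda>x. \<Sum>i\<in>I. D i x)" for D
    using identifiable_summands_distinct[OF assms(1-4) D] assms(3,4) D(2)
    by (auto simp: P_def card_image sum.reindex)
  have "\<exists>!\<B>. P \<B>" using assms(2) by (simp add: identifiable_def P_def)
  then show ?thesis using P[OF assms(5,6)] P[OF assms(7,8)] by blast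
qed

text \<open>Asking for this at a single entry \<open>x\<close> keeps it a finite set of polynomial
  inequations. Coordinates are compared only up to order because swapping one coordinate between two
  grid points never changes the product of their summands.\<close>

definition generic_at :: "nat \<Rightarrow> (nat \<Rightarrow> nat) \<Rightarrow> (nat \<Rightarrow> nat) \<Rightarrow> (nat \<Rightarrow> nat \<Rightarrow> 'k::comm_ring_1 tensor) \<Rightarrow> bool" where
  "generic_at m r x A \<longleftrightarrow>
     (\<forall>i\<in>grid m r. \<forall>j\<in>grid m r. \<forall>p\<in>grid m r. \<forall>q\<in>grid m r.
        summand m A i x * summand m A j x = summand m A p x * summand m A q x \<longrightarrow>
        (\<forall>c\<in>{1..m}. i c = p c \<and> j c = q c \<or> i c = q c \<and> j c = p c))"

text \<open>Only \<open>A\<close> has to be generic. The summands of any other decomposition are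
  those of \<open>A\<close> in another order, so its rectangle relations become relations between
  summands of \<open>A\<close>, and its entries inherit nonvanishing.\<close>

theorem HHD_unique_of_identifiable:
  fixes T :: "'k::field_char_0 tensor"
  assumes d: "d \<ge> 1" and m: "m \<ge> 1" and n: "\<forall>j\<in>{1..d}. n j \<ge> 1" and r: "\<forall>k\<in>{1..m}. r k \<ge> 2"
    and HHD: "is_HHD d n m r T A"
    and nz: "\<forall>k\<in>{1..m}. \<forall>i\<in>{1..r k}. \<forall>x\<in>multi_indices d n. A k i x \<noteq> 0"
    and x0: "x0 \<in> multi_indices d n" and gen: "generic_at m r x0 A"
    and ident: "identifiable d n (\<Prod>k\<in>{1..m}. r k) T"
  shows "HHD_unique_up_to_symmetries d n m r T A"
  unfolding HHD_unique_up_to_symmetries_def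
proof (intro allI impI)
  fix A' assume HHD': "is_HHD d n m r T A'"
  define G where "G = grid m r"
  have finG: "finite G" "card G = (\<Prod>k\<in>{1..m}. r k)"
    by (simp_all add: G_def finite_grid card_grid)
  have Gk: "i k \<in> {1..r k}" if "i \<in> G" "k \<in> {1..m}" for i k
    using that by (auto simp: G_def grid_def)
  have r1: "rank_one d n (C k i)"
    if "is_HHD d n m r T C" "k \<in> {1..m}" "i \<in> {1..r k}" for C k i
  proof -
    have "C \<in> (\<Pi>\<^sub>E k\<in>{1..m}. \<Pi>\<^sub>E i\<in>{1..r k}. {T. rank_one d n T})"
      using that(1) by (simp only: is_HHD_def rank_one_tuples_def)
    from PiE_mem[OF PiE_mem[OF this that(2)] that(3)] show ?thesis by simp
  qed
  have decomp: "T = (\<lambda>x. \<Sum>i\<in>G. summand m C i x)" if "is_HHD d n m r T C" for C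
    using that by (simp add: is_HHD_def hadamard_of_sums_eq_sum_summands G_def)
  have seg: "summand m C i \<in> segre d n" if "is_HHD d n m r T C" "i \<in> G" for C i
    using that Gk r1 m by (intro summand_in_segre) auto
  have inj: "inj_on (summand m A) G"
    using identifiable_summands_distinct(1)[OF d ident finG seg[OF HHD] decomp[OF HHD]] .
  have inj': "inj_on (summand m A') G"
    using identifiable_summands_distinct(1)[OF d ident finG seg[OF HHD'] decomp[OF HHD']] .
  have img: "summand m A' ` G = summand m A ` G"
    using identifiable_summands_unique[OF d ident finG seg[OF HHD'] decomp[OF HHD'] seg[OF HHD] decomp[OF HHD]] .
  define \<sigma> where "\<sigma> i = inv_into G (summand m A) (summand m A' i)" for i
  have \<sigma>: "\<sigma> i \<in> G" "summand m A (\<sigma> i) = summand m A' i" if "i \<in> G" for i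
  proof -
    have "summand m A' i \<in> summand m A ` G" using img that by blast
    then show "\<sigma> i \<in> G" "summand m A (\<sigma> i) = summand m A' i"
      unfolding \<sigma>_def by (simp_all add: inv_into_into f_inv_into_f)
  qed
  have inj\<sigma>: "inj_on \<sigma> G"
    using inj' \<sigma>(2) by (metis inj_on_def)
  have upd: "i(k := a) \<in> G" if "i \<in> G" "k \<in> {1..m}" "a \<in> {1..r k}" for i k a
    using that unfolding G_def grid_def by (rule PiE_fun_upd_same)
  have "\<exists>\<psi> \<pi>. \<psi> permutes {1..m} \<and> (\<forall>k\<in>{1..m}. r (\<psi> k) = r k) \<and>
      (\<forall>k\<in>{1..m}. \<pi> k permutes {1..r k}) \<and> (\<forall>i\<in>G. \<forall>k\<in>{1..m}. \<sigma> i (\<psi> k) = \<pi> k (i k))"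
    unfolding G_def grid_def
  proof (rule grid_bijection_of_exchange)
    show "r k \<ge> 2" if "k \<in> {1..m}" for k using r that by blast
    show "inj_on \<sigma> (\<Pi>\<^sub>E k\<in>{1..m}. {1..r k})" using inj\<sigma> by (simp add: G_def grid_def)
    show "\<sigma> i \<in> (\<Pi>\<^sub>E k\<in>{1..m}. {1..r k})" if "i \<in> (\<Pi>\<^sub>E k\<in>{1..m}. {1..r k})" for i
      using \<sigma>(1)[of i] that by (simp add: G_def grid_def)
    fix i k l a b c
    assume "i \<in> (\<Pi>\<^sub>E k\<in>{1..m}. {1..r k})" and kl: "k \<in> {1..m}" "l \<in> {1..m}" "k \<noteq> l"
      and ab: "a \<in> {1..r k}" "b \<in> {1..r l}" and c: "c \<in> {1..m}"
    then have i: "i \<in> G" by (simp add: G_def grid_def)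
    have ia: "i(k := a) \<in> G" and ib: "i(l := b) \<in> G" using upd i kl ab by auto
    have iab: "i(k := a, l := b) \<in> G" using upd[OF ia kl(2) ab(2)] .
    have "summand m A' i x0 * summand m A' (i(k := a, l := b)) x0 =
        summand m A' (i(k := a)) x0 * summand m A' (i(l := b)) x0"
      unfolding summand_apply prod.distrib[symmetric] using kl by (intro prod.cong) auto
    then have "summand m A (\<sigma> i) x0 * summand m A (\<sigma> (i(k := a, l := b))) x0 =
        summand m A (\<sigma> (i(k := a))) x0 * summand m A (\<sigma> (i(l := b))) x0"
      by (simp only: \<sigma>(2) i ia ib iab)
    then show "\<sigma> i c = \<sigma> (i(k := a)) c \<and> \<sigma> (i(l := b)) c = \<sigma> (i(k := a, l := b)) c \<or>
        \<sigma> i c = \<sigma> (i(l := b)) c \<and> \<sigma> (i(k := a)) c = \<sigma> (i(k := a, l := b)) c"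
      using gen \<sigma>(1)[OF i] \<sigma>(1)[OF ia] \<sigma>(1)[OF ib] \<sigma>(1)[OF iab] c
      unfolding generic_at_def G_def by (metis (no_types, lifting))
  qed
  then obtain \<psi> \<pi> where \<psi>: "\<psi> permutes {1..m}" "\<And>k. k \<in> {1..m} \<Longrightarrow> r (\<psi> k) = r k"
    and \<pi>: "\<And>k. k \<in> {1..m} \<Longrightarrow> \<pi> k permutes {1..r k}"
    and \<sigma>\<pi>: "\<And>i k. i \<in> G \<Longrightarrow> k \<in> {1..m} \<Longrightarrow> \<sigma> i (\<psi> k) = \<pi> k (i k)" by blast
  define E where "E k i = A (\<psi> k) (\<pi> k i)" for k i
  have \<psi>mem: "\<psi> k \<in> {1..m}" "\<pi> k i \<in> {1..r (\<psi> k)}" if "k \<in> {1..m}" "i \<in> {1..r k}" for k i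
    using that \<psi> permutes_in_image[OF \<psi>(1)] permutes_in_image[OF \<pi>[OF that(1)]] by auto
  have Enz: "E k i x \<noteq> 0" if "k \<in> {1..m}" "i \<in> {1..r k}" "x \<in> multi_indices d n" for k i x
    using nz \<psi>mem[OF that(1,2)] that(3) by (auto simp: E_def)
  have Er1: "rank_one d n (E k i)" if "k \<in> {1..m}" "i \<in> {1..r k}" for k i
    using r1[OF HHD] \<psi>mem[OF that] by (auto simp: E_def)
  have eq: "summand m A' i x = summand m E i x" if "i \<in> G" for i x
  proof -
    have "summand m A' i x = (\<Prod>c\<in>{1..m}. A c (\<sigma> i c) x)"
      using \<sigma>(2)[OF that] by (metis summand_apply)
    also have "\<dots> = (\<Prod>k\<in>{1..m}. A (\<psi> k) (\<sigma> i (\<psi> k)) x)"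
      using prod.permute[OF \<psi>(1), of "\<lambda>c. A c (\<sigma> i c) x"] by simp
    also have "\<dots> = summand m E i x"
      using \<sigma>\<pi>[OF that] by (simp add: summand_apply E_def)
    finally show ?thesis .
  qed
  \<comment> \<open>Every \<open>A' k i\<close> is a factor of some summand, and that summand equals
    a product of nonvanishing entries of \<open>A\<close>.\<close>
  have A'nz: "A' k i x \<noteq> 0" if k: "k \<in> {1..m}" and i: "i \<in> {1..r k}" and x: "x \<in> multi_indices d n" for k i x
  proof -
    obtain h where h: "h \<in> G" "h k = i" using grid_through[OF k i r] by (auto simp: G_def)
    have "summand m E h x \<noteq> 0"
      using Enz Gk[OF h(1)] x by (simp add: summand_apply)
    then have "(\<Prod>k\<in>{1..m}. A' k (h k) x) \<noteq> 0" using eq[OF h(1)] by (simp add: summand_apply)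
    then show ?thesis using h k by auto
  qed
  define D where "D k = (\<lambda>x. A' k 1 x / E k 1 x)" for k
  have one: "1 \<in> {1..r k}" if "k \<in> {1..m}" for k using r that by force
  have Dr1: "rank_one d n (D k)" if "k \<in> {1..m}" for k
    unfolding D_def using that one Enz A'nz Er1 r1[OF HHD'] by (intro rank_one_quotient n) auto
  have Dnz: "D k x \<noteq> 0" if "k \<in> {1..m}" "x \<in> multi_indices d n" for k x
    using that Enz A'nz one by (simp add: D_def)
  define i0 where "i0 = (\<lambda>k\<in>{1..m}. 1::nat)"
  have i0: "i0 \<in> G" using one by (auto simp: i0_def G_def grid_def)
  have Dprod: "hadamard_prod {1..m} D = ones_tensor d n"
  proof
    fix x
    show "hadamard_prod {1..m} D x = ones_tensor d n x"
    proof (cases "x \<in> multi_indices d n")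
      case True
      have "(\<Prod>k\<in>{1..m}. A' k 1 x) = (\<Prod>k\<in>{1..m}. E k 1 x)"
        using eq[OF i0, of x] by (simp add: summand_apply i0_def)
      moreover have "(\<Prod>k\<in>{1..m}. E k 1 x) \<noteq> 0" using Enz one True by simp
      ultimately show ?thesis using True
        by (simp add: hadamard_prod_def D_def prod_dividef ones_tensor_def)
    next
      case False
      \<comment> \<open>Here \<open>m \<ge> 1\<close> matters: an empty product would be 1 off the
        multi-indices.\<close>
      have "1 \<in> {1..m}" using m by simp
      then have "D 1 x = 0" using rank_one_eq_0[OF Dr1 False] by blast
      then show ?thesis using False \<open>1 \<in> {1..m}\<close>
        by (auto simp: hadamard_prod_def ones_tensor_def intro!: prod_zero)
    qed
  qed
  have "A' k i = hadamard (D k) (A (\<psi> k) (\<pi> k i))" if k: "k \<in> {1..m}" and i: "i \<in> {1..r k}" for k i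
  proof
    fix x
    show "A' k i x = hadamard (D k) (A (\<psi> k) (\<pi> k i)) x"
    proof (cases "x \<in> multi_indices d n")
      case False
      then show ?thesis
        using rank_one_eq_0[OF r1[OF HHD' k i]] rank_one_eq_0[OF Dr1[OF k]] by (simp add: hadamard_def)
    next
      case True
      have ki: "summand m C (i0(k := u)) x = C k u x * (\<Prod>l\<in>{1..m} - {k}. C l 1 x)" for C u
        
      proof -
        have "(\<Prod>l\<in>{1..m} - {k}. C l ((i0(k := u)) l) x) = (\<Prod>l\<in>{1..m} - {k}. C l 1 x)"
          by (intro prod.cong) (auto simp: i0_def)
        then show ?thesis
          using prod.remove[OF _ k, of "\<lambda>l. C l ((i0(k := u)) l) x"] by (simp add: summand_apply)
      qed
      have i0k: "i0(k := 1) = i0" using k by (auto simp: i0_def)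
      \<comment> \<open>Grid points that differ from \<open>i0\<close> only at \<open>k\<close>
        share the cofactors \<open>a\<close> and \<open>e\<close>. Comparing index \<open>i\<close>
        with index 1 eliminates them, so the quotient of \<open>A'\<close> by \<open>E\<close> does
        not depend on \<open>i\<close>.\<close>
      define a e where "a = (\<Prod>l\<in>{1..m} - {k}. A' l 1 x)" and "e = (\<Prod>l\<in>{1..m} - {k}. E l 1 x)"
      have ai: "A' k i x * a = E k i x * e"
        using eq[OF upd[OF i0 k i], of x] by (simp only: ki a_def e_def)
      have a1: "A' k 1 x * a = E k 1 x * e"
        using eq[OF upd[OF i0 k one[OF k]], of x] by (simp only: ki a_def e_def)
      have "A' k i x * E k 1 x * a = A' k i x * a * E k 1 x" by (simp only: ac_simps)
      also have "\<dots> = E k 1 x * e * E k i x" unfolding ai by (simp only: ac_simps)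
      also have "\<dots> = A' k 1 x * E k i x * a" unfolding a1[symmetric] by (simp only: ac_simps)
      finally have "A' k i x * E k 1 x * a = A' k 1 x * E k i x * a" .
      moreover have "a \<noteq> 0" using A'nz one True by (simp add: a_def)
      ultimately have "A' k i x * E k 1 x = A' k 1 x * E k i x" by simp
      moreover have "E k 1 x \<noteq> 0" using Enz[OF k one[OF k] True] .
      ultimately have "A' k i x = A' k 1 x / E k 1 x * E k i x"
        by (simp add: field_simps)
      then show ?thesis by (simp add: hadamard_def D_def E_def)
    qed
  qed
  then show "\<exists>\<psi> \<pi> D. \<psi> permutes {1..m} \<and> (\<forall>k\<in>{1..m}. r (\<psi> k) = r k) \<and>
      (\<forall>k\<in>{1..m}. \<pi> k permutes {1..r k}) \<and>
      (\<forall>k\<in>{1..m}. rank_one d n (D k) \<and> (\<forall>x\<in>multi_indices d n. D k x \<noteq> 0)) \<and>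
      hadamard_prod {1..m} D = ones_tensor d n \<and>
      (\<forall>k\<in>{1..m}. \<forall>i\<in>{1..r k}. A' k i = hadamard (D k) (A (\<psi> k) (\<pi> k i)))"
    using \<psi> \<pi> Dr1 Dnz Dprod by blast
qed

section \<open>Reshaping and identifiability\<close>

text \<open>The Kronecker product of the factor vectors with modes in \<open>X\<close>, which is one
  of the three vectors left after reshaping.\<close>

definition block :: "(nat \<Rightarrow> nat) \<Rightarrow> nat set \<Rightarrow> (nat \<Rightarrow> nat \<Rightarrow> 'k::comm_ring_1) \<Rightarrow> (nat \<Rightarrow> nat) \<Rightarrow> 'k" where
  "block n X a p = (if p \<in> (\<Pi>\<^sub>E j\<in>X. {1..n j}) then \<Prod>j\<in>X. a j (p j) else 0)"

text \<open>Fixing the indices outside \<open>X\<close> at 1 recovers a block, up to a constant,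
  from entries of the tensor. This avoids choosing factor vectors and keeps conditions on blocks
  polynomial in the entries.\<close>

definition extend_by_1 :: "nat \<Rightarrow> nat set \<Rightarrow> (nat \<Rightarrow> nat) \<Rightarrow> nat \<Rightarrow> nat" where
  "extend_by_1 d X p = (\<lambda>j\<in>{1..d}. if j \<in> X then p j else 1)"

lemma extend_by_1_mem:
  assumes "\<forall>j\<in>{1..d}. n j \<ge> 1" "X \<subseteq> {1..d}" "p \<in> (\<Pi>\<^sub>E j\<in>X. {1..n j})"
  shows "extend_by_1 d X p \<in> multi_indices d n"
  using assms by (force simp: extend_by_1_def multi_indices_def)

lemma rank_one_tensor_extend_by_1:
  assumes "\<forall>j\<in>{1..d}. n j \<ge> 1" "X \<subseteq> {1..d}" "p \<in> (\<Pi>\<^sub>E j\<in>X. {1..n j})"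
  shows "rank_one_tensor d n a (extend_by_1 d X p) = block n X a p * (\<Prod>j\<in>{1..d} - X. a j 1)"
proof -
  have "rank_one_tensor d n a (extend_by_1 d X p) = (\<Prod>j\<in>{1..d}. a j (if j \<in> X then p j else 1))"
    using extend_by_1_mem[OF assms]
    by (auto simp: rank_one_tensor_def extend_by_1_def intro!: prod.cong)
  also have "\<dots> = (\<Prod>j\<in>{1..d} - X. a j (if j \<in> X then p j else 1)) * (\<Prod>j\<in>X. a j (if j \<in> X then p j else 1))"
    using assms(2) by (intro prod.subset_diff) auto
  also have "\<dots> = block n X a p * (\<Prod>j\<in>{1..d} - X. a j 1)"
    using assms(3) by (simp add: block_def mult.commute)
  finally show ?thesis .
qed

text \<open>A subfamily of size the minimum is small enough for the independence hypothesis. Passing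
  from tensor entries to blocks only divides each column by a nonzero constant.\<close>

lemma min_le_dim_blocks:
  fixes a :: "'e \<Rightarrow> nat \<Rightarrow> nat \<Rightarrow> 'k::field"
  assumes "\<forall>j\<in>{1..d}. n j \<ge> 1" "X \<subseteq> {1..d}" "finite S"
    and nz: "\<And>e x. e \<in> S \<Longrightarrow> x \<in> multi_indices d n \<Longrightarrow> rank_one_tensor d n (a e) x \<noteq> 0"
    and indep: "\<And>S'. S' \<subseteq> S \<Longrightarrow> card S' \<le> (\<Prod>j\<in>X. n j) \<Longrightarrow>
      columns_independent (\<Pi>\<^sub>E j\<in>X. {1..n j}) S' (\<lambda>p e. rank_one_tensor d n (a e) (extend_by_1 d X p))"
  shows "min (\<Prod>j\<in>X. n j) (card S) \<le> fun_vs.dim ((\<lambda>e. block n X (a e)) ` S)"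
proof -
  obtain S' where S': "S' \<subseteq> S" "card S' = min (\<Prod>j\<in>X. n j) (card S)"
    using obtain_subset_with_card_n[of "min (\<Prod>j\<in>X. n j) (card S)" S] by auto
  have finS': "finite S'" using S'(1) assms(3) finite_subset by blast
  have "\<forall>e\<in>S'. c e = 0" if c: "(\<Sum>e\<in>S'. fscale (c e) (block n X (a e))) \<in> fun_vs.span {}" for c
  proof -
    define l where "l e = c e / (\<Prod>j\<in>{1..d} - X. a e j 1)" for e
    have const: "(\<Prod>j\<in>{1..d} - X. a e j 1) \<noteq> 0" if e: "e \<in> S'" for e
    proof -
      have "a e j 1 \<noteq> 0" if "j \<in> {1..d}" for j
        using rank_one_tensor_factor_nonzero[OF assms(1) _ that, of "a e" 1] nz[of e] e S'(1) assms(1) that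
        by auto
      then show ?thesis by simp
    qed
    have "(\<Sum>e\<in>S'. l e * rank_one_tensor d n (a e) (extend_by_1 d X p)) = 0"
      if p: "p \<in> (\<Pi>\<^sub>E j\<in>X. {1..n j})" for p
    proof -
      have "(\<Sum>e\<in>S'. l e * rank_one_tensor d n (a e) (extend_by_1 d X p)) = (\<Sum>e\<in>S'. c e * block n X (a e) p)"
        using const by (intro sum.cong) (auto simp: l_def rank_one_tensor_extend_by_1[OF assms(1,2) p])
      also have "\<dots> = (\<Sum>e\<in>S'. fscale (c e) (block n X (a e))) p" by (simp add: sum_fun_apply)
      also have "\<dots> = 0" using c by simp
      finally show ?thesis .
    qed
    then have "\<forall>e\<in>S'. l e = 0"
      using indep[OF S'(1)] S'(2) unfolding columns_independent_def by auto
    then show ?thesis using const by (auto simp: l_def)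
  qed
  then have "fun_vs.dim ({} :: ((nat \<Rightarrow> nat) \<Rightarrow> 'k) set) + card S' \<le>
      fun_vs.dim ({} \<union> (\<lambda>e. block n X (a e)) ` S')"
    by (intro fun_vs.card_le_dim_of_independent_mod finS') auto
  also have "\<dots> \<le> fun_vs.dim ((\<lambda>e. block n X (a e)) ` S)"
    using S'(1) assms(3) by (intro fun_vs.dim_le_finite) (auto intro: fun_vs.span_base)
  finally show ?thesis using S'(2) by simp
qed

definition merge3 :: "nat \<Rightarrow> nat set \<Rightarrow> nat set \<Rightarrow> (nat \<Rightarrow> nat) \<Rightarrow> (nat \<Rightarrow> nat) \<Rightarrow> (nat \<Rightarrow> nat) \<Rightarrow> nat \<Rightarrow> nat" where
  "merge3 d I J p q s = (\<lambda>j\<in>{1..d}. if j \<in> I then p j else if j \<in> J then q j else s j)"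

lemma blocks_eq_rank_one_tensor:
  assumes IJK: "I \<union> J \<union> K = {1..d}" "I \<inter> J = {}" "I \<inter> K = {}" "J \<inter> K = {}"
  shows "block n I a p * block n J a q * block n K a s =
    (if p \<in> (\<Pi>\<^sub>E j\<in>I. {1..n j}) \<and> q \<in> (\<Pi>\<^sub>E j\<in>J. {1..n j}) \<and> s \<in> (\<Pi>\<^sub>E j\<in>K. {1..n j})
     then rank_one_tensor d n a (merge3 d I J p q s) else 0)"
proof (cases "p \<in> (\<Pi>\<^sub>E j\<in>I. {1..n j}) \<and> q \<in> (\<Pi>\<^sub>E j\<in>J. {1..n j}) \<and> s \<in> (\<Pi>\<^sub>E j\<in>K. {1..n j})")
  case True
  define x where "x = merge3 d I J p q s"
  have fin: "finite I" "finite J" "finite K" using IJK(1) by (metis finite_Un finite_atLeastAtMost)+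
  have sub: "j \<in> {1..d}" if "j \<in> I \<or> j \<in> J \<or> j \<in> K" for j using IJK(1) that by blast
  have x: "x \<in> multi_indices d n"
    using True IJK(1) unfolding x_def merge3_def multi_indices_def
    by (auto simp: PiE_iff)
  have "(\<Prod>j\<in>{1..d}. a j (x j)) = (\<Prod>j\<in>I \<union> J. a j (x j)) * (\<Prod>j\<in>K. a j (x j))"
    unfolding IJK(1)[symmetric] using fin IJK by (intro prod.union_disjoint) auto
  also have "(\<Prod>j\<in>I \<union> J. a j (x j)) = (\<Prod>j\<in>I. a j (x j)) * (\<Prod>j\<in>J. a j (x j))"
    using fin IJK by (intro prod.union_disjoint) auto
  also have "(\<Prod>j\<in>I. a j (x j)) = (\<Prod>j\<in>I. a j (p j))"
    using sub by (intro prod.cong) (auto simp: x_def merge3_def)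
  also have "(\<Prod>j\<in>J. a j (x j)) = (\<Prod>j\<in>J. a j (q j))"
    using sub IJK by (intro prod.cong) (auto simp: x_def merge3_def)
  also have "(\<Prod>j\<in>K. a j (x j)) = (\<Prod>j\<in>K. a j (s j))"
    using sub IJK by (intro prod.cong) (auto simp: x_def merge3_def)
  finally show ?thesis using True x by (simp add: block_def rank_one_tensor_def x_def[symmetric])
qed (auto simp: block_def)

lemma merge3_restrict:
  assumes "I \<union> J \<union> K = {1..d}" "x \<in> multi_indices d n"
  shows "merge3 d I J (restrict x I) (restrict x J) (restrict x K) = x"
proof
  fix j show "merge3 d I J (restrict x I) (restrict x J) (restrict x K) j = x j"
    using assms by (cases "j \<in> {1..d}") (auto simp: merge3_def multi_indices_def PiE_iff extensional_def)
qed

lemma restrict_multi_index: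
  "x \<in> multi_indices d n \<Longrightarrow> X \<subseteq> {1..d} \<Longrightarrow> restrict x X \<in> (\<Pi>\<^sub>E j\<in>X. {1..n j})"
  by (auto simp: multi_indices_def PiE_iff)

text \<open>Reshaping along \<open>I \<squnion> J \<squnion> K = [d]\<close> turns decompositions into ones of order three.\<close>
lemma decomposition_unique:
  fixes B :: "'i \<Rightarrow> 'k::field tensor" and C :: "'j \<Rightarrow> 'k tensor"
  assumes n: "\<forall>j\<in>{1..d}. n j \<ge> 1"
    and IJK: "I \<union> J \<union> K = {1..d}" "I \<inter> J = {}" "I \<inter> K = {}" "J \<inter> K = {}"
    and fin: "finite S" "finite U" "card U \<le> card S"
    and B: "\<And>i. i \<in> S \<Longrightarrow> rank_one d n (B i)"
    and C: "\<And>i. i \<in> U \<Longrightarrow> rank_one d n (C i)"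
    and nz: "\<And>i x. i \<in> S \<Longrightarrow> x \<in> multi_indices d n \<Longrightarrow> B i x \<noteq> 0"
    and indep: "\<And>X S'. X \<in> {I, J, K} \<Longrightarrow> S' \<subseteq> S \<Longrightarrow> card S' \<le> (\<Prod>j\<in>X. n j) \<Longrightarrow>
      columns_independent (\<Pi>\<^sub>E j\<in>X. {1..n j}) S' (\<lambda>p i. B i (extend_by_1 d X p))"
    and range: "\<And>p. 2 \<le> p \<Longrightarrow> p \<le> card S \<Longrightarrow>
      2 * p + 2 \<le> min (\<Prod>j\<in>I. n j) p + min (\<Prod>j\<in>J. n j) p + min (\<Prod>j\<in>K. n j) p"
    and eq: "(\<lambda>x. \<Sum>i\<in>S. B i x) = (\<lambda>x. \<Sum>i\<in>U. C i x)"
  shows "\<exists>\<beta>. bij_betw \<beta> S U \<and> (\<forall>i\<in>S. C (\<beta> i) = B i)"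
proof -
  obtain b where b: "\<And>i. i \<in> S \<Longrightarrow> B i = rank_one_tensor d n (b i)"
    using B unfolding rank_one_iff by metis
  obtain c where c: "\<And>i. i \<in> U \<Longrightarrow> C i = rank_one_tensor d n (c i)"
    using C unfolding rank_one_iff by metis
  \<comment> \<open>\<open>kruskal_uniqueness\<close> treats both decompositions as one family over
    disjoint index sets; the sum type provides this even when \<open>S\<close> and \<open>U\<close>
    overlap or have different types.\<close>
  define a where "a = case_sum b c"
  define x where "x X e = block n X (a e)" for X e
  have sub: "X \<subseteq> {1..d}" if "X \<in> {I, J, K}" for X using IJK(1) that by auto
  have x3: "x I e p * x J e q * x K e s =
    (if p \<in> (\<Pi>\<^sub>E j\<in>I. {1..n j}) \<and> q \<in> (\<Pi>\<^sub>E j\<in>J. {1..n j}) \<and> s \<in> (\<Pi>\<^sub>E j\<in>K. {1..n j})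
     then rank_one_tensor d n (a e) (merge3 d I J p q s) else 0)" for e p q s
    unfolding x_def by (rule blocks_eq_rank_one_tensor[OF IJK])
  have x3r: "x I e (restrict y I) * x J e (restrict y J) * x K e (restrict y K) = rank_one_tensor d n (a e) y"
    if "y \<in> multi_indices d n" for e y
    using restrict_multi_index[OF that] sub by (simp add: x3 merge3_restrict[OF IJK(1) that])
  have aS: "rank_one_tensor d n (a (Inl i)) = B i" if "i \<in> S" for i using that b by (simp add: a_def)
  have aU: "rank_one_tensor d n (a (Inr i)) = C i" if "i \<in> U" for i using that c by (simp add: a_def)
  have one: "(\<lambda>j\<in>{1..d}. 1) \<in> multi_indices d n" using n by (auto simp: multi_indices_def)
  have "\<exists>\<beta>. bij_betw \<beta> (Inl ` S) (Inr ` U) \<and>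
      (\<forall>e\<in>Inl ` S. \<forall>p q s. x I e p * x J e q * x K e s = x I (\<beta> e) p * x J (\<beta> e) q * x K (\<beta> e) s)"
  proof (rule kruskal_uniqueness)
    show "\<exists>p q s. x I e p * x J e q * x K e s \<noteq> 0" if e: "e \<in> Inl ` S" for e
    proof -
      obtain i where "i \<in> S" "e = Inl i" using e by blast
      then have "rank_one_tensor d n (a e) (\<lambda>j\<in>{1..d}. 1) \<noteq> 0" using aS nz one by simp
      then show ?thesis using x3r[OF one] by metis
    qed
    show "(\<Sum>e\<in>Inl ` S. x I e p * x J e q * x K e s) = (\<Sum>e\<in>Inr ` U. x I e p * x J e q * x K e s)" for p q s
    proof -
      define y where "y = merge3 d I J p q s"
      have "(\<Sum>i\<in>S. rank_one_tensor d n (a (Inl i)) y) = (\<Sum>i\<in>S. B i y)"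
        using aS by (intro sum.cong) auto
      also have "\<dots> = (\<Sum>i\<in>U. C i y)" using fun_cong[OF eq, of y] .
      also have "\<dots> = (\<Sum>i\<in>U. rank_one_tensor d n (a (Inr i)) y)"
        using aU by (intro sum.cong) auto
      finally have eqy: "(\<Sum>i\<in>S. rank_one_tensor d n (a (Inl i)) y) = (\<Sum>i\<in>U. rank_one_tensor d n (a (Inr i)) y)" .
      define Q where "Q \<longleftrightarrow>
        p \<in> (\<Pi>\<^sub>E j\<in>I. {1..n j}) \<and> q \<in> (\<Pi>\<^sub>E j\<in>J. {1..n j}) \<and> s \<in> (\<Pi>\<^sub>E j\<in>K. {1..n j})"
      have xQ: "x I e p * x J e q * x K e s = (if Q then rank_one_tensor d n (a e) y else 0)" for e
        by (simp only: x3 Q_def y_def)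
      show ?thesis unfolding xQ using eqy by (cases Q) (simp_all add: sum.reindex)
    qed
    fix S0 :: "('i + 'j) set"
    assume S0: "S0 \<subseteq> Inl ` S" "card S0 \<ge> 2"
    have "min (\<Prod>j\<in>X. n j) (card S0) \<le> fun_vs.dim (x X ` S0)" if X: "X \<in> {I, J, K}" for X
      unfolding x_def
    proof (rule min_le_dim_blocks[OF n sub[OF X]])
      show "finite S0" using S0(1) fin(1) finite_subset by blast
      show "rank_one_tensor d n (a e) y \<noteq> 0" if "e \<in> S0" "y \<in> multi_indices d n" for e y
        using that S0(1) aS nz by force
      fix S1 assume S1: "S1 \<subseteq> S0" "card S1 \<le> (\<Prod>j\<in>X. n j)"
      then obtain S2 where S2: "S2 \<subseteq> S" "S1 = Inl ` S2" using S0(1) by (meson subset_imageE subset_trans)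
      then have "card S2 \<le> (\<Prod>j\<in>X. n j)" using S1(2) by (simp add: card_image)
      note ind = indep[OF X S2(1) this]
      show "columns_independent (\<Pi>\<^sub>E j\<in>X. {1..n j}) S1 (\<lambda>p e. rank_one_tensor d n (a e) (extend_by_1 d X p))"
        unfolding columns_independent_def S2(2)
      proof (intro allI impI ballI)
        fix l :: "'i + 'j \<Rightarrow> 'k" and e :: "'i + 'j"
        assume l: "\<forall>p\<in>\<Pi>\<^sub>E j\<in>X. {1..n j}.
          (\<Sum>e\<in>Inl ` S2. l e * rank_one_tensor d n (a e) (extend_by_1 d X p)) = 0" and e: "e \<in> Inl ` S2"
        have "(\<Sum>i\<in>S2. l (Inl i) * B i (extend_by_1 d X p)) = 0" if "p \<in> (\<Pi>\<^sub>E j\<in>X. {1..n j})" for p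
        proof -
          have "(\<Sum>i\<in>S2. l (Inl i) * B i (extend_by_1 d X p)) =
              (\<Sum>i\<in>S2. l (Inl i) * rank_one_tensor d n (a (Inl i)) (extend_by_1 d X p))"
            using S2(1) aS by (intro sum.cong) auto
          then show ?thesis using l that by (simp add: sum.reindex)
        qed
        then have "\<forall>i\<in>S2. l (Inl i) = 0"
          using ind[unfolded columns_independent_def, THEN spec, of "\<lambda>i. l (Inl i)"] by simp
        then show "l e = 0" using e by auto
      qed
    qed
    from this[of I] this[of J] this[of K]
    have "min (\<Prod>j\<in>I. n j) (card S0) + min (\<Prod>j\<in>J. n j) (card S0) + min (\<Prod>j\<in>K. n j) (card S0) \<le>
        fun_vs.dim (x I ` S0) + fun_vs.dim (x J ` S0) + fun_vs.dim (x K ` S0)" by simp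
    moreover have "card S0 \<le> card S"
      using card_mono[OF _ S0(1)] fin(1) by (simp add: card_image)
    ultimately show "2 * card S0 + 2 \<le> fun_vs.dim (x I ` S0) + fun_vs.dim (x J ` S0) + fun_vs.dim (x K ` S0)"
      using range[OF S0(2)] by linarith
  qed (use fin in \<open>auto simp: card_image\<close>)
  then obtain \<beta> :: "'i + 'j \<Rightarrow> 'i + 'j" where \<beta>: "bij_betw \<beta> (Inl ` S) (Inr ` U)"
    "\<And>i p q s. i \<in> S \<Longrightarrow> x I (Inl i) p * x J (Inl i) q * x K (Inl i) s =
       x I (\<beta> (Inl i)) p * x J (\<beta> (Inl i)) q * x K (\<beta> (Inl i)) s" by blast
  have inr: "\<exists>j\<in>U. \<beta> (Inl i) = Inr j" if "i \<in> S" for i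
    using bij_betwE[OF \<beta>(1)] that by blast
  define \<gamma> where "\<gamma> = projr \<circ> (\<beta> \<circ> Inl)"
  have "bij_betw \<gamma> S U"
    unfolding \<gamma>_def
  proof (intro bij_betw_trans)
    show "bij_betw Inl S (Inl ` S)" by (intro inj_on_imp_bij_betw) auto
    show "bij_betw projr (Inr ` U) U" by (auto simp: bij_betw_def inj_on_def image_image)
  qed (rule \<beta>(1))
  moreover have "C (\<gamma> i) = B i" if i: "i \<in> S" for i
  proof
    fix y
    obtain j where j: "j \<in> U" "\<beta> (Inl i) = Inr j" using inr[OF i] by blast
    show "C (\<gamma> i) y = B i y"
    proof (cases "y \<in> multi_indices d n")
      case True
      have "B i y = rank_one_tensor d n (a (Inl i)) y" using aS[OF i] by simp
      also have "\<dots> = rank_one_tensor d n (a (Inr j)) y"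
        using \<beta>(2)[OF i] x3r[OF True] j(2) by metis
      finally show ?thesis using aU[OF j(1)] j(2) by (simp add: \<gamma>_def)
    next
      case False
      then show ?thesis using rank_one_eq_0[OF B[OF i] False] rank_one_eq_0[OF C[OF j(1)] False] j(2)
        by (simp add: \<gamma>_def)
    qed
  qed
  ultimately show ?thesis by blast
qed

text \<open>Uniqueness holds against all decompositions with at most \<open>card S\<close> terms. As
  it yields a bijection, no shorter one exists, so rank and uniqueness come from one
  statement.\<close>

lemma identifiable_of_independent:
  fixes B :: "'i \<Rightarrow> 'k::field_char_0 tensor"
  assumes n: "\<forall>j\<in>{1..d}. n j \<ge> 1"
    and IJK: "I \<union> J \<union> K = {1..d}" "I \<inter> J = {}" "I \<inter> K = {}" "J \<inter> K = {}"
    and fin: "finite S"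
    and B: "\<And>i. i \<in> S \<Longrightarrow> rank_one d n (B i)"
    and nz: "\<And>i x. i \<in> S \<Longrightarrow> x \<in> multi_indices d n \<Longrightarrow> B i x \<noteq> 0"
    and indep: "\<And>X S'. X \<in> {I, J, K} \<Longrightarrow> S' \<subseteq> S \<Longrightarrow> card S' \<le> (\<Prod>j\<in>X. n j) \<Longrightarrow>
      columns_independent (\<Pi>\<^sub>E j\<in>X. {1..n j}) S' (\<lambda>p i. B i (extend_by_1 d X p))"
    and two: "(\<Prod>j\<in>I. n j) \<ge> 2"
    and range: "\<And>p. 2 \<le> p \<Longrightarrow> p \<le> card S \<Longrightarrow>
      2 * p + 2 \<le> min (\<Prod>j\<in>I. n j) p + min (\<Prod>j\<in>J. n j) p + min (\<Prod>j\<in>K. n j) p"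
  shows "identifiable d n (card S) (\<lambda>x. \<Sum>i\<in>S. B i x)"
proof -
  define T where "T = (\<lambda>x. \<Sum>i\<in>S. B i x)"
  have unique: "\<exists>\<beta>. bij_betw \<beta> S U \<and> (\<forall>i\<in>S. C (\<beta> i) = B i)"
    if "finite U" "card U \<le> card S" "\<And>i. i \<in> U \<Longrightarrow> rank_one d n (C i)" "T = (\<lambda>x. \<Sum>i\<in>U. C i x)"
    for U :: "'u set" and C
    by (rule decomposition_unique[OF n IJK fin that(1,2)])
      (use B that(3) nz indep range that(4) in \<open>auto simp: T_def\<close>)
  have inj: "inj_on B S"
  proof (rule inj_onI, rule ccontr)
    fix i j assume ij: "i \<in> S" "j \<in> S" "B i = B j" "i \<noteq> j"
    \<comment> \<open>Two equal summands are dependent with coefficients 1 and -1, whereas a pair of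
      columns is independent because the block of \<open>I\<close> has at least two entries.\<close>
    then have "columns_independent (\<Pi>\<^sub>E j\<in>I. {1..n j}) {i, j} (\<lambda>p i. B i (extend_by_1 d I p))"
      using two by (intro indep) auto
    moreover have "(\<Sum>k\<in>{i, j}. (if k = i then 1 else - 1) * B k (extend_by_1 d I p)) = 0" for p
      using ij by simp
    ultimately have "\<forall>k\<in>{i, j}. (if k = i then 1 else - 1 :: 'k) = 0"
      unfolding columns_independent_def
      by (elim allE[of _ "\<lambda>k. if k = i then 1 else - 1"] mp) blast
    then show False by simp
  qed
  have "tensor_rank d n T = card S"
    unfolding tensor_rank_def
  proof (rule Least_equality)
    obtain h where h: "bij_betw h {1..card S} S"
      using ex_bij_betw_nat_finite_1[OF fin] by blast
    have "T = (\<lambda>x. \<Sum>i\<in>{1..card S}. B (h i) x)"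
      unfolding T_def by (intro ext sum.reindex_bij_betw[OF h, symmetric])
    moreover have "\<forall>i\<in>{1..card S}. rank_one d n (B (h i))"
      using h B by (auto simp: bij_betw_def)
    ultimately show "\<exists>C. (\<forall>i\<in>{1..card S}. rank_one d n (C i)) \<and> T = (\<lambda>x. \<Sum>i\<in>{1..card S}. C i x)"
      by (intro exI[of _ "\<lambda>i. B (h i)"]) auto
  next
    fix s :: nat
    assume "\<exists>C. (\<forall>i\<in>{1..s}. rank_one d n (C i)) \<and> T = (\<lambda>x. \<Sum>i\<in>{1..s}. C i x)"
    then obtain C where C: "\<And>i. i \<in> {1..s} \<Longrightarrow> rank_one d n (C i)" "T = (\<lambda>x. \<Sum>i\<in>{1..s}. C i x)" by blast
    show "card S \<le> s"
    proof (rule ccontr)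
      assume "\<not> card S \<le> s"
      then obtain \<beta> where "bij_betw \<beta> S {1..s}" using unique[OF _ _ C] by auto
      then show False using \<open>\<not> card S \<le> s\<close> bij_betw_same_card by fastforce
    qed
  qed
  moreover have "\<exists>!\<B>. finite \<B> \<and> card \<B> = card S \<and> (\<forall>B\<in>\<B>. rank_one d n B) \<and> T = (\<lambda>x. \<Sum>B\<in>\<B>. B x)"
  proof (rule ex1I[of _ "B ` S"])
    show "finite (B ` S) \<and> card (B ` S) = card S \<and> (\<forall>B\<in>B ` S. rank_one d n B) \<and> T = (\<lambda>x. \<Sum>B\<in>B ` S. B x)"
      using fin inj B by (auto simp: card_image sum.reindex T_def)
    fix \<B> assume \<B>: "finite \<B> \<and> card \<B> = card S \<and> (\<forall>B\<in>\<B>. rank_one d n B) \<and> T = (\<lambda>x. \<Sum>B\<in>\<B>. B x)"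
    then obtain \<beta> where \<beta>: "bij_betw \<beta> S \<B>" "\<forall>i\<in>S. \<beta> i = B i"
      using unique[of \<B> "\<lambda>B. B"] by auto
    have "\<beta> ` S = B ` S" using \<beta>(2) by (intro image_cong) auto
    then show "\<B> = B ` S" using \<beta>(1) by (simp add: bij_betw_def)
  qed
  ultimately show ?thesis by (simp add: identifiable_def T_def)
qed

text \<open>The inequality needs p \<ge> 2 for p up to c, c \<ge> 2 up to b, p \<le> b + c - 2 up to
  a, and 2p + 2 \<le> a + b + c beyond. The last two are the bounds in the minimum, since a +
  \<delta> = b + c - 2 and a + \<delta>/2 = (a + b + c - 2)/2.\<close>

lemma min_sum_of_reshaped_kruskal:
  fixes a b c R p :: nat
  assumes "a \<ge> b" "b \<ge> c" "c \<ge> 2" "2 \<le> p" "p \<le> R"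
    and R: "real R \<le> real a + min ((real b + real c - real a - 2) / 2) (real b + real c - real a - 2)"
  shows "2 * p + 2 \<le> min a p + min b p + min c p"
proof -
  have "real R \<le> real a + (real b + real c - real a - 2) / 2" "real R \<le> real b + real c - 2"
    using R by linarith+
  then have "real (2 * R + 2) \<le> real (a + b + c)" "real (R + 2) \<le> real (b + c)"
    by (simp_all add: field_simps)
  then have 1: "2 * R + 2 \<le> a + b + c" and 2: "R + 2 \<le> b + c"
    by (simp_all only: of_nat_le_iff)
  show ?thesis using 1 2 assms(1-5) by (simp add: min_def)
qed

section \<open>A common witness\<close>

text \<open>The newly inserted coordinate carries the digit \<open>e mod n a\<close> with weight 1;
  the others represent \<open>e div n a\<close>, their weights multiplied by \<open>n a\<close>.
  Digits are \<open>p j - 1\<close> since indices start at 1.\<close>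

lemma mixed_radix_weights:
  fixes n :: "nat \<Rightarrow> nat"
  assumes "finite X"
  shows "\<exists>w. \<forall>e<(\<Prod>j\<in>X. n j). \<exists>p\<in>(\<Pi>\<^sub>E j\<in>X. {1..n j}). (\<Sum>j\<in>X. w j * (p j - 1)) = e"
  using assms
proof (induction X rule: finite_induct)
  case empty
  then show ?case by simp
next
  case (insert a X)
  then obtain w where w: "\<And>e. e < (\<Prod>j\<in>X. n j) \<Longrightarrow>
    \<exists>p\<in>(\<Pi>\<^sub>E j\<in>X. {1..n j}). (\<Sum>j\<in>X. w j * (p j - 1)) = e" by blast
  define w' where "w' j = (if j = a then 1 else n a * w j)" for j
  have "\<exists>p\<in>(\<Pi>\<^sub>E j\<in>insert a X. {1..n j}). (\<Sum>j\<in>insert a X. w' j * (p j - 1)) = e"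
    if e: "e < (\<Prod>j\<in>insert a X. n j)" for e
  proof -
    have e': "e < (\<Prod>j\<in>X. n j) * n a" using e insert.hyps by (simp add: mult.commute)
    then have na: "n a > 0" by (cases "n a") auto
    obtain p where p: "p \<in> (\<Pi>\<^sub>E j\<in>X. {1..n j})" "(\<Sum>j\<in>X. w j * (p j - 1)) = e div n a"
      using w[OF less_mult_imp_div_less[OF e']] by blast
    define p' where "p' = p(a := e mod n a + 1)"
    have "e mod n a + 1 \<in> {1..n a}" using na by (simp add: Suc_le_eq)
    then have "p' \<in> (\<Pi>\<^sub>E j\<in>insert a X. {1..n j})"
      unfolding p'_def using p(1) by (intro PiE_fun_upd)
    moreover have "(\<Sum>j\<in>X. w' j * (p' j - 1)) = n a * (\<Sum>j\<in>X. w j * (p j - 1))"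
      unfolding sum_distrib_left using insert.hyps
      by (intro sum.cong) (auto simp: w'_def p'_def)
    then have "(\<Sum>j\<in>insert a X. w' j * (p' j - 1)) = e"
      using insert.hyps p(2) by (simp add: w'_def p'_def)
    ultimately show ?thesis by blast
  qed
  then show ?case by blast
qed

lemma prime_labels:
  "\<exists>P :: nat \<Rightarrow> nat \<Rightarrow> nat. (\<forall>k i. prime (P k i)) \<and> (\<forall>k i k' i'. P k i = P k' i' \<longrightarrow> k = k' \<and> i = i')"
proof -
  obtain f :: "nat \<Rightarrow> nat" where f: "inj f" "range f \<subseteq> {p. prime p}"
    using infinite_countable_subset[OF primes_infinite] by blast
  show ?thesis
    using f by (intro exI[of _ "\<lambda>k i. f (prod_encode (k, i))"]) (auto dest: injD simp: image_subset_iff)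
qed

text \<open>The primes dividing \<open>t h\<close> reveal the coordinates of \<open>h\<close>. The
  equation thus determines the set of the two values at \<open>c\<close>, and equal sets of at most
  two elements match up to order.\<close>

lemma prime_label_products_exchange:
  fixes P :: "nat \<Rightarrow> nat \<Rightarrow> nat" and m :: nat
  defines "t \<equiv> \<lambda>i. \<Prod>k\<in>{1..m}. P k (i k)"
  assumes P: "\<And>k i. prime (P k i)" "\<And>k i k' i'. P k i = P k' i' \<Longrightarrow> k = k' \<and> i = i'"
    and eq: "t i * t j = t p * t q" and c: "c \<in> {1..m}"
  shows "i c = p c \<and> j c = q c \<or> i c = q c \<and> j c = p c"
proof -
  have dvd: "P c u dvd t h \<longleftrightarrow> h c = u" for u h
  proof
    assume "P c u dvd t h"
    then obtain k where "k \<in> {1..m}" "P c u dvd P k (h k)"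
      using P(1) unfolding t_def by (auto simp: prime_dvd_prod_iff)
    then have "P c u = P k (h k)" using P(1) by (intro primes_dvd_imp_eq)
    from P(2)[OF this] show "h c = u" by simp
  next
    assume "h c = u"
    then show "P c u dvd t h" unfolding t_def using c by (auto intro: dvd_prodI)
  qed
  have "(i c = u \<or> j c = u) \<longleftrightarrow> (p c = u \<or> q c = u)" for u
    using arg_cong[OF eq, of "\<lambda>x. P c u dvd x"] P(1) by (simp add: prime_dvd_mult_iff dvd)
  then show ?thesis by metis
qed

text \<open>With \<open>P k i\<close> distinct primes, the summand with multi-index \<open>i\<close> has entries \<open>t\<^sub>i ^ (1 + e(x))\<close>, where
  \<open>t\<^sub>i\<close> is the product of the \<open>P k (i k)\<close>. Choosing \<open>w\<close> as mixed radix weights on each of the blocks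
  \<open>I\<close>, \<open>J\<close>, \<open>K\<close> makes the three reshaped factors Vandermonde vectors with distinct nodes.\<close>
definition power_tuple ::
  "nat \<Rightarrow> (nat \<Rightarrow> nat) \<Rightarrow> nat \<Rightarrow> (nat \<Rightarrow> nat) \<Rightarrow> (nat \<Rightarrow> nat) \<Rightarrow> (nat \<Rightarrow> nat \<Rightarrow> nat) \<Rightarrow>
     nat \<Rightarrow> nat \<Rightarrow> 'k::field_char_0 tensor" where
  "power_tuple d n m r w P = (\<lambda>k\<in>{1..m}. \<lambda>i\<in>{1..r k}. \<lambda>x.
     if x \<in> multi_indices d n then of_nat (P k i) ^ (1 + (\<Sum>j\<in>{1..d}. w j * (x j - 1))) else 0)"

lemma power_tuple_in_segre_tuples:
  assumes "d \<ge> 1"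
  shows "(power_tuple d n m r w P :: nat \<Rightarrow> nat \<Rightarrow> 'k::field_char_0 tensor) \<in> segre_tuples d n m r"
proof -
  have "(power_tuple d n m r w P k i :: 'k tensor) \<in> segre d n" if "k \<in> {1..m}" "i \<in> {1..r k}" for k i
  proof -
    define c :: 'k where "c = of_nat (P k i)"
    \<comment> \<open>The extra exponent 1 is assigned to the first mode, which exists because
      \<open>d \<ge> 1\<close>.\<close>
    have "(\<Prod>j\<in>{1..d}. c ^ ((if j = 1 then 1 else 0) + w j * (x j - 1))) =
        c ^ (1 + (\<Sum>j\<in>{1..d}. w j * (x j - 1)))" for x :: "nat \<Rightarrow> nat"
    proof -
      have "(\<Sum>j\<in>{1..d}. (if j = 1 then 1 else 0 :: nat)) = 1" using assms by simp
      then show ?thesis by (simp only: power_sum[symmetric] sum.distrib)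
    qed
    then have "(power_tuple d n m r w P k i :: 'k tensor) =
        rank_one_tensor d n (\<lambda>j y. c ^ ((if j = 1 then 1 else 0) + w j * (y - 1)))"
      using that by (auto simp: power_tuple_def rank_one_tensor_def c_def)
    then show ?thesis by (simp only: rank_one_tensor_in_segre)
  qed
  moreover have "(power_tuple d n m r w P k :: nat \<Rightarrow> 'k tensor) \<in> extensional {1..r k}" if "k \<in> {1..m}" for k
    using that by (simp add: power_tuple_def)
  ultimately show ?thesis
    unfolding segre_tuples_def
    by (intro PiE_I) (auto simp: PiE_iff power_tuple_def)
qed

lemma summand_power_tuple:
  assumes "i \<in> grid m r" "x \<in> multi_indices d n"
  shows "summand m (power_tuple d n m r w P) i x =
    of_nat (\<Prod>k\<in>{1..m}. P k (i k)) ^ (1 + (\<Sum>j\<in>{1..d}. w j * (x j - 1)))"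
proof -
  have "summand m (power_tuple d n m r w P) i x =
      (\<Prod>k\<in>{1..m}. of_nat (P k (i k)) ^ (1 + (\<Sum>j\<in>{1..d}. w j * (x j - 1))))"
    unfolding summand_apply using assms
    by (intro prod.cong) (auto simp: power_tuple_def grid_def PiE_iff)
  then show ?thesis by (simp only: prod_power_distrib of_nat_prod)
qed

text \<open>The weights realize every exponent below the number of entries of the block, so the rows
  contain a square Vandermonde system with nodes \<open>t i\<close>; the common extra power of
  \<open>t i\<close> goes into the coefficients.\<close>

lemma power_tuple_columns_independent:
  fixes w :: "nat \<Rightarrow> nat" and P :: "nat \<Rightarrow> nat \<Rightarrow> nat" and m :: nat
  defines "t \<equiv> \<lambda>i. \<Prod>k\<in>{1..m}. P k (i k)"
  assumes n: "\<forall>j\<in>{1..d}. n j \<ge> 1" and X: "X \<subseteq> {1..d}"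
    and w: "\<And>e. e < (\<Prod>j\<in>X. n j) \<Longrightarrow> \<exists>p\<in>(\<Pi>\<^sub>E j\<in>X. {1..n j}). (\<Sum>j\<in>X. w j * (p j - 1)) = e"
    and inj: "inj_on t (grid m r)" and pos: "\<And>i. i \<in> grid m r \<Longrightarrow> t i > 0"
    and S: "S \<subseteq> grid m r" "card S \<le> (\<Prod>j\<in>X. n j)"
  shows "columns_independent (\<Pi>\<^sub>E j\<in>X. {1..n j}) S
    (\<lambda>p i. summand m (power_tuple d n m r w P :: nat \<Rightarrow> nat \<Rightarrow> 'k::field_char_0 tensor) i (extend_by_1 d X p))"
  unfolding columns_independent_def
proof (intro allI impI)
  fix l :: "(nat \<Rightarrow> nat) \<Rightarrow> 'k"
  assume l: "\<forall>p\<in>\<Pi>\<^sub>E j\<in>X. {1..n j}.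
    (\<Sum>i\<in>S. l i * summand m (power_tuple d n m r w P) i (extend_by_1 d X p)) = 0"
  have "\<forall>i\<in>S. l i * of_nat (t i) = 0"
  proof (rule vandermonde_independent[where t = "\<lambda>i. of_nat (t i)"])
    show "finite S" using S(1) finite_grid finite_subset by blast
    show "inj_on (\<lambda>i. of_nat (t i) :: 'k) S"
      using inj S(1) by (auto simp: inj_on_def)
    fix e assume "e < card S"
    then obtain p where p: "p \<in> (\<Pi>\<^sub>E j\<in>X. {1..n j})" "(\<Sum>j\<in>X. w j * (p j - 1)) = e"
      using w[of e] S(2) by auto
    note mem = extend_by_1_mem[OF n X p(1)]
    \<comment> \<open>Padded positions have index 1 and contribute exponent 0.\<close>
    have "(\<Sum>j\<in>{1..d}. w j * (extend_by_1 d X p j - 1)) = (\<Sum>j\<in>X. w j * (extend_by_1 d X p j - 1))"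
      using X by (intro sum.mono_neutral_right) (auto simp: extend_by_1_def)
    also have "\<dots> = e" unfolding p(2)[symmetric] using X
      by (intro sum.cong) (auto simp: extend_by_1_def)
    finally have ex: "(\<Sum>j\<in>{1..d}. w j * (extend_by_1 d X p j - 1)) = e" .
    have "(\<Sum>i\<in>S. l i * of_nat (t i) * of_nat (t i) ^ e) =
        (\<Sum>i\<in>S. l i * summand m (power_tuple d n m r w P) i (extend_by_1 d X p))"
      using S(1) by (intro sum.cong refl)
        (simp add: summand_power_tuple[OF _ mem] subset_iff ex[unfolded One_nat_def] t_def mult.assoc)
    then show "(\<Sum>i\<in>S. l i * of_nat (t i) * of_nat (t i) ^ e) = 0" using l p(1) by simp
  qed
  then show "\<forall>i\<in>S. l i = 0" using pos S(1) by fastforce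
qed

section \<open>Polynomial conditions on tuples of tensors\<close>

lemma coordinate_polynomial:
  "k \<in> {1..m} \<Longrightarrow> i \<in> {1..r k} \<Longrightarrow> x \<in> multi_indices d n \<Longrightarrow>
     (\<lambda>A. A k i x) \<in> polynomial_functions (tuple_coordinates d n m r)"
  by (rule polynomial_functions.coord) (auto simp: tuple_coordinates_def)

lemma summand_polynomial:
  assumes "i \<in> grid m r" "x \<in> multi_indices d n"
  shows "(\<lambda>A. summand m A i x) \<in> polynomial_functions (tuple_coordinates d n m r)"
  unfolding summand_apply
  using assms by (intro polynomial_functions_prod coordinate_polynomial) (auto simp: grid_def)

text \<open>For each quadruple of grid points either the conclusion holds outright or the difference
  of the two products is a polynomial that is nonzero at \<open>A0\<close>.\<close>

lemma open_around_generic_at: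
  fixes A0 :: "nat \<Rightarrow> nat \<Rightarrow> 'k::idom tensor"
  assumes x: "x \<in> multi_indices d n" and "generic_at m r x A0"
  shows "open_around (tuple_coordinates d n m r) A0 (generic_at m r x)"
proof -
  define swap where "swap i j p q \<longleftrightarrow>
    (\<forall>c\<in>{1..m}. i c = p c \<and> j c = q c \<or> i c = q c \<and> j c = (p c :: nat))" for i j p q :: "nat \<Rightarrow> nat"
  have "open_around (tuple_coordinates d n m r) A0
      (\<lambda>A. summand m A i x * summand m A j x = summand m A p x * summand m A q x \<longrightarrow> swap i j p q)"
    if mem: "i \<in> grid m r" "j \<in> grid m r" "p \<in> grid m r" "q \<in> grid m r" for i j p q
  proof (cases "swap i j p q")
    case True
    have "open_around (tuple_coordinates d n m r) A0 (\<lambda>A. \<forall>s\<in>{}. False)" by (rule open_around_ball) auto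
    then show ?thesis using True by (rule_tac open_around_mono) auto
  next
    case False
    have "open_around (tuple_coordinates d n m r) A0
        (\<lambda>A. summand m A i x * summand m A j x - summand m A p x * summand m A q x \<noteq> 0)"
    proof (rule open_around_poly)
      show "(\<lambda>A. summand m A i x * summand m A j x - summand m A p x * summand m A q x)
          \<in> polynomial_functions (tuple_coordinates d n m r)"
        using mem x by (intro polynomial_functions_diff polynomial_functions.mult summand_polynomial)
      show "summand m A0 i x * summand m A0 j x - summand m A0 p x * summand m A0 q x \<noteq> 0"
      proof
        assume "summand m A0 i x * summand m A0 j x - summand m A0 p x * summand m A0 q x = 0"
        then have "summand m A0 i x * summand m A0 j x = summand m A0 p x * summand m A0 q x" by simp
        then have "swap i j p q"
          using assms(2)[unfolded generic_at_def, THEN bspec, OF mem(1), THEN bspec, OF mem(2),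
              THEN bspec, OF mem(3), THEN bspec, OF mem(4)] unfolding swap_def by (rule_tac mp)
        then show False using False by contradiction
      qed
    qed
    then show ?thesis by (rule open_around_mono) auto
  qed
  then show ?thesis
    unfolding generic_at_def swap_def
    by (intro open_around_ball finite_grid)
qed

lemma for_generic_HHD_of_open_around:
  assumes "A0 \<in> segre_tuples d n m r" "open_around (tuple_coordinates d n m r) A0 Q'"
    and "\<And>T A. is_HHD d n m r T A \<Longrightarrow> Q' A \<Longrightarrow> Q T A"
  shows "for_generic_HHD d n m r Q"
proof -
  obtain f where f: "f \<in> polynomial_functions (tuple_coordinates d n m r)" "f A0 \<noteq> 0"
    "\<And>A. f A \<noteq> 0 \<Longrightarrow> Q' A" using assms(2) unfolding open_around_def by blast
  define Z where "Z = {A \<in> segre_tuples d n m r. \<forall>p\<in>{f}. p A = 0}"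
  have closed: "zariski_closed_in_segre_tuples d n m r Z"
    unfolding zariski_closed_in_segre_tuples_def Z_def using f(1) by (intro exI[of _ "{f}"]) auto
  have proper: "Z \<subset> segre_tuples d n m r" using assms(1) f(2) unfolding Z_def by auto
  have "Q T A" if HHD: "is_HHD d n m r T A" and "A \<notin> Z" for T A
  proof -
    have "rank_one_tuples d n m r \<subseteq> segre_tuples d n m r"
      unfolding rank_one_tuples_def segre_tuples_def by (intro PiE_mono) (auto simp: segre_def)
    then have "A \<in> segre_tuples d n m r" using HHD by (auto simp: is_HHD_def)
    then have "f A \<noteq> 0" using that(2) by (simp add: Z_def)
    then show ?thesis using assms(3)[OF HHD] f(3) by blast
  qed
  then show ?thesis unfolding for_generic_HHD_def using closed proper by blast
qed

theorem mainTheorem1: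
  fixes d m R :: nat and n r :: "nat \<Rightarrow> nat"
  assumes "d \<ge> 3" and "m \<ge> 1"
    and "\<forall>j\<in>{1..d}. n j \<ge> 1"
    and "\<forall>k\<in>{1..m}. r k \<ge> 2"
    and "R = (\<Prod>k\<in>{1..m}. r k)"
  shows "for_generic_HHD d n m r
           (\<lambda>(T :: 'k::field_char_0 tensor) A.
              identifiable d n R T \<longrightarrow> HHD_unique_up_to_symmetries d n m r T A) \<and>
         (in_reshaped_kruskal_range d n R \<longrightarrow>
            for_generic_HHD d n m r
              (\<lambda>(T :: 'k tensor) A.
                 identifiable d n R T \<and> HHD_unique_up_to_symmetries d n m r T A))"
proof -
  note n = assms(3)
  have d: "d \<ge> 1" using assms(1) by simp
  define x0 where "x0 = (\<lambda>j\<in>{1..d}. 1 :: nat)"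
  have x0: "x0 \<in> multi_indices d n" using n by (auto simp: x0_def multi_indices_def)
  obtain P :: "nat \<Rightarrow> nat \<Rightarrow> nat" where P: "\<And>k i. prime (P k i)"
    "\<And>k i k' i'. P k i = P k' i' \<Longrightarrow> k = k' \<and> i = i'" using prime_labels by metis
  define t where "t i = (\<Prod>k\<in>{1..m}. P k (i k))" for i
  have tpos: "t i > 0" for i unfolding t_def using P(1) by (intro prod_pos) (auto simp: prime_gt_0_nat)
  have tinj: "inj_on t (grid m r)"
  proof (rule inj_onI)
    fix i j assume ij: "i \<in> grid m r" "j \<in> grid m r" "t i = t j"
    have "i c = j c" if "c \<in> {1..m}" for c
    proof -
      have "(\<Prod>k\<in>{1..m}. P k (i k)) * (\<Prod>k\<in>{1..m}. P k (i k)) =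
          (\<Prod>k\<in>{1..m}. P k (j k)) * (\<Prod>k\<in>{1..m}. P k (j k))"
        using ij(3) by (simp only: t_def)
      from prime_label_products_exchange[OF P this that] show ?thesis by blast
    qed
    then show "i = j" using ij(1,2) unfolding grid_def by (intro PiE_ext)
  qed
  \<comment> \<open>The weights stay free: \<open>good\<close> holds around the witness for all of
    them, and only the second part makes a special choice.\<close>
  define A0 :: "(nat \<Rightarrow> nat) \<Rightarrow> nat \<Rightarrow> nat \<Rightarrow> 'k tensor" where
    "A0 w = power_tuple d n m r w P" for w
  define good :: "(nat \<Rightarrow> nat \<Rightarrow> 'k tensor) \<Rightarrow> bool" where
    "good A \<longleftrightarrow> (\<forall>k\<in>{1..m}. \<forall>i\<in>{1..r k}. \<forall>x\<in>multi_indices d n. A k i x \<noteq> 0) \<and> generic_at m r x0 A" for A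
  have A0: "A0 w \<in> segre_tuples d n m r" for w
    unfolding A0_def by (rule power_tuple_in_segre_tuples[OF d])
  have good: "open_around (tuple_coordinates d n m r) (A0 w) good" for w
    unfolding good_def
  proof (intro open_around_conj)
    show "open_around (tuple_coordinates d n m r) (A0 w)
        (\<lambda>A. \<forall>k\<in>{1..m}. \<forall>i\<in>{1..r k}. \<forall>x\<in>multi_indices d n. A k i x \<noteq> 0)"
    proof (intro open_around_ball open_around_poly coordinate_polynomial finite_multi_indices)
      fix k i x assume "k \<in> {1..m}" "i \<in> {1..r k}" "x \<in> multi_indices d n"
      then show "A0 w k i x \<noteq> 0" using P(1)[of k i] prime_gt_0_nat
        by (auto simp: A0_def power_tuple_def)
    qed auto
    have "generic_at m r x0 (A0 w)"
      unfolding generic_at_def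
    proof (intro ballI impI)
      fix i j p q c
      assume mem: "i \<in> grid m r" "j \<in> grid m r" "p \<in> grid m r" "q \<in> grid m r" "c \<in> {1..m}"
        and eq: "summand m (A0 w) i x0 * summand m (A0 w) j x0 = summand m (A0 w) p x0 * summand m (A0 w) q x0"
      \<comment> \<open>At the all-ones index the weighted exponents vanish and only the added 1
        remains.\<close>
      have "summand m (A0 w) h x0 = of_nat (t h)" if "h \<in> grid m r" for h
        using summand_power_tuple[OF that x0] by (simp add: A0_def t_def x0_def)
      then have "(of_nat (t i * t j) :: 'k) = of_nat (t p * t q)"
        using eq mem by simp
      then have "t i * t j = t p * t q" by (simp only: of_nat_eq_iff)
      from prime_label_products_exchange[OF P this[unfolded t_def] mem(5)]
      show "i c = p c \<and> j c = q c \<or> i c = q c \<and> j c = p c" .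
    qed
    then show "open_around (tuple_coordinates d n m r) (A0 w) (generic_at m r x0)"
      by (rule open_around_generic_at[OF x0])
  qed
  have unique: "HHD_unique_up_to_symmetries d n m r T A"
    if "is_HHD d n m r T A" "good A" "identifiable d n R T" for T A
    using that HHD_unique_of_identifiable[OF d assms(2) n assms(4) that(1) _ x0] assms(5)
    unfolding good_def by blast
  have part1: "for_generic_HHD d n m r
      (\<lambda>(T :: 'k tensor) A. identifiable d n R T \<longrightarrow> HHD_unique_up_to_symmetries d n m r T A)"
    using unique by (intro for_generic_HHD_of_open_around[OF A0 good]) blast
  have part2: "for_generic_HHD d n m r
      (\<lambda>(T :: 'k tensor) A. identifiable d n R T \<and> HHD_unique_up_to_symmetries d n m r T A)"
    if range: "in_reshaped_kruskal_range d n R"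
  proof -
    obtain I J K where IJK: "I \<union> J \<union> K = {1..d}" "I \<inter> J = {}" "I \<inter> K = {}" "J \<inter> K = {}"
      and ge: "(\<Prod>j\<in>J. n j) \<le> (\<Prod>j\<in>I. n j)" "(\<Prod>j\<in>K. n j) \<le> (\<Prod>j\<in>J. n j)" "(\<Prod>j\<in>K. n j) \<ge> 2"
      and R: "real R \<le> real (\<Prod>j\<in>I. n j) +
        min ((real (\<Prod>j\<in>J. n j) + real (\<Prod>j\<in>K. n j) - real (\<Prod>j\<in>I. n j) - 2) / 2)
          (real (\<Prod>j\<in>J. n j) + real (\<Prod>j\<in>K. n j) - real (\<Prod>j\<in>I. n j) - 2)"
      using range unfolding in_reshaped_kruskal_range_def Let_def by blast
    have sub: "X \<subseteq> {1..d}" if "X \<in> {I, J, K}" for X using IJK(1) that by auto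
    have finX: "finite X" if "X \<in> {I, J, K}" for X using sub[OF that] finite_subset by blast
    define rep where "rep w X \<longleftrightarrow>
      (\<forall>e<(\<Prod>j\<in>X. n j). \<exists>p\<in>(\<Pi>\<^sub>E j\<in>X. {1..n j}). (\<Sum>j\<in>X. w j * (p j - 1)) = e)" for w X
    have rep_cong: "rep w X" if "rep w' X" "\<And>j. j \<in> X \<Longrightarrow> w j = w' j" for w w' X
      using that by (simp add: rep_def cong: sum.cong)
    obtain w1 w2 w3 where w123: "rep w1 I" "rep w2 J" "rep w3 K"
      using mixed_radix_weights[of I n] mixed_radix_weights[of J n] mixed_radix_weights[of K n] finX
      unfolding rep_def by blast
    \<comment> \<open>The blocks are disjoint, so one weight function represents all exponents on
      each of the three, and one witness serves them all.\<close>
    define w where "w j = (if j \<in> I then w1 j else if j \<in> J then w2 j else w3 j)" for j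
    have "rep w I" by (rule rep_cong[OF w123(1)]) (simp add: w_def)
    moreover have "rep w J" using IJK by (intro rep_cong[OF w123(2)]) (auto simp: w_def)
    moreover have "rep w K" using IJK by (intro rep_cong[OF w123(3)]) (auto simp: w_def)
    ultimately have rep: "rep w X" if "X \<in> {I, J, K}" for X using that by blast
    define indep :: "nat set \<Rightarrow> (nat \<Rightarrow> nat) set \<Rightarrow> (nat \<Rightarrow> nat \<Rightarrow> 'k tensor) \<Rightarrow> bool" where
      "indep X S A \<longleftrightarrow> columns_independent (\<Pi>\<^sub>E j\<in>X. {1..n j}) S (\<lambda>p i. summand m A i (extend_by_1 d X p))"
      for X S A
    have "open_around (tuple_coordinates d n m r) (A0 w)
        (\<lambda>A. good A \<and> (\<forall>X\<in>{I, J, K}. \<forall>S\<in>{S. S \<subseteq> grid m r \<and> card S \<le> (\<Prod>j\<in>X. n j)}. indep X S A))"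
    proof (intro open_around_conj good open_around_ball)
      fix X S assume X: "X \<in> {I, J, K}" and "S \<in> {S. S \<subseteq> grid m r \<and> card S \<le> (\<Prod>j\<in>X. n j)}"
      then have S: "S \<subseteq> grid m r" "card S \<le> (\<Prod>j\<in>X. n j)" by auto
      show "open_around (tuple_coordinates d n m r) (A0 w) (indep X S)"
        unfolding indep_def
      proof (rule open_around_columns_independent)
        show "finite S" using S(1) finite_grid finite_subset by blast
        show "(\<lambda>A. summand m A i (extend_by_1 d X p)) \<in> polynomial_functions (tuple_coordinates d n m r)"
          if "p \<in> (\<Pi>\<^sub>E j\<in>X. {1..n j})" "i \<in> S" for p i
          using that S(1) by (intro summand_polynomial extend_by_1_mem[OF n sub[OF X]]) auto
        show "columns_independent (\<Pi>\<^sub>E j\<in>X. {1..n j}) S (\<lambda>p i. summand m (A0 w) i (extend_by_1 d X p))"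
          unfolding A0_def
        proof (rule power_tuple_columns_independent[OF n sub[OF X] _ _ _ S])
          show "\<exists>p\<in>(\<Pi>\<^sub>E j\<in>X. {1..n j}). (\<Sum>j\<in>X. w j * (p j - 1)) = e" if "e < (\<Prod>j\<in>X. n j)" for e
            using rep[OF X] that unfolding rep_def by blast
          show "inj_on (\<lambda>i. \<Prod>k\<in>{1..m}. P k (i k)) (grid m r)" using tinj unfolding t_def .
          show "(\<Prod>k\<in>{1..m}. P k (i k)) > 0" for i using tpos[of i] unfolding t_def .
        qed
      qed
    next
      show "finite {S. S \<subseteq> grid m r \<and> card S \<le> (\<Prod>j\<in>X. n j)}" for X
        by (rule finite_subset[of _ "Pow (grid m r)"]) (auto simp: finite_grid)
    qed auto
    then show ?thesis
    proof (rule for_generic_HHD_of_open_around[OF A0])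
      fix T A assume HHD: "is_HHD d n m r T A"
        and A: "good A \<and> (\<forall>X\<in>{I, J, K}. \<forall>S\<in>{S. S \<subseteq> grid m r \<and> card S \<le> (\<Prod>j\<in>X. n j)}. indep X S A)"
      have Anz: "A k i x \<noteq> 0" if "k \<in> {1..m}" "i \<in> {1..r k}" "x \<in> multi_indices d n" for k i x
        using A that unfolding good_def by blast
      have gridk: "i k \<in> {1..r k}" if "i \<in> grid m r" "k \<in> {1..m}" for i k
        using that by (auto simp: grid_def)
      have nz: "summand m A i x \<noteq> 0" if "i \<in> grid m r" "x \<in> multi_indices d n" for i x
        using Anz gridk that by (simp add: summand_apply)
      have "identifiable d n (card (grid m r)) (\<lambda>x. \<Sum>i\<in>grid m r. summand m A i x)"
      proof (rule identifiable_of_independent[OF n IJK finite_grid])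
        show "rank_one d n (summand m A i)" if i: "i \<in> grid m r" for i
        proof -
          have "rank_one d n (A k (i k))" if k: "k \<in> {1..m}" for k
          proof -
            have "A \<in> (\<Pi>\<^sub>E k\<in>{1..m}. \<Pi>\<^sub>E i\<in>{1..r k}. {T. rank_one d n T})"
              using HHD by (simp only: is_HHD_def rank_one_tuples_def)
            from PiE_mem[OF PiE_mem[OF this k] gridk[OF i k]] show ?thesis by simp
          qed
          then have "summand m A i \<in> segre d n" using assms(2) by (intro summand_in_segre) auto
          then show ?thesis using nz[OF i x0] by (auto simp: segre_def)
        qed
        show "columns_independent (\<Pi>\<^sub>E j\<in>X. {1..n j}) S (\<lambda>p i. summand m A i (extend_by_1 d X p))"
          if "X \<in> {I, J, K}" "S \<subseteq> grid m r" "card S \<le> (\<Prod>j\<in>X. n j)" for X S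
          using A that unfolding indep_def by blast
        show "2 * p + 2 \<le> min (\<Prod>j\<in>I. n j) p + min (\<Prod>j\<in>J. n j) p + min (\<Prod>j\<in>K. n j) p"
          if "2 \<le> p" "p \<le> card (grid m r)" for p
          using that ge R assms(5) by (intro min_sum_of_reshaped_kruskal[of _ _ _ _ R]) (auto simp: card_grid)
      qed (use nz ge in auto)
      then have "identifiable d n R T"
        using HHD assms(5) by (simp add: is_HHD_def hadamard_of_sums_eq_sum_summands card_grid)
      then show "identifiable d n R T \<and> HHD_unique_up_to_symmetries d n m r T A"
        using unique[OF HHD] A by blast
    qed
  qed
  show ?thesis using part1 part2 by blast
qed

end
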